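(* Let $G$ be an $(s,k)$-edge-connected graph such that $k\geq 2$ and $\deg(s)\geq 4$. (1) Any two maximal independent sets of $L(G,s,k)$ intersect in at most one vertex. (2) If the union of two intersecting maximal independent sets of $L(G,s,k)$ equals $V(L(G,s,k))$, then $\deg(s)$ is odd and both sets have size $(\deg(s)+1)/2$. (3) If $\deg(s)>4$ and there exist two intersecting maximal independent sets of $L(G,s,k)$ of size $\lceil \deg(s)/2\rceil$, then $L(G,s,k)$ is the disjoint union of an isolated vertex and a balanced complete bipartite graph; in particular these two sets are the only maximal independent sets of $L(G,s,k)$, and the isolated vertex is their intersection. (4) If $k$ is even and either $\deg(s)$ is even or at most one independent set of $L(G,s,k)$ has size $\lceil\deg(s)/2\rceil$, then the maximal independent sets of $L(G,s,k)$ are pairwise disjoint (i.e. $L(G,s,k)$ is complete multipartite). Moreover, if $L(G,s,k)$ is complete multipartite, then it is not a star.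
   Context: All graphs are finite loopless multigraphs. A graph $G$ is $(s,k)$-edge-connected if $G$ has at least three vertices, $s$ is a vertex of $G$, $k$ is a positive integer, and any two vertices of $G$ both different from $s$ are joined by $k$ pairwise edge-disjoint paths in $G$ (these paths may pass through $s$). Lifting two edges $sv,sw$ incident with $s$ means deleting them and adding a new edge $vw$ if $v\neq w$, and only deleting them if $v=w$; call the result $G_{v,w}$. Edges $sv,sw$ form a $k$-liftable pair if $G_{v,w}$ is $(s,k)$-edge-connected. The $k$-lifting graph $L(G,s,k)$ has as vertices the edges of $G$ incident with $s$, two being adjacent iff they form a $k$-liftable pair. *)

theory Defs
  imports Complex_Main "HOL-Library.Disjoint_Sets"
begin

text \<open>Edges are named objects, so that parallel edges are distinguished; two edges are parallel
  when they have the same set of ends.\<close>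

record ('v, 'e) multigraph =
  verts :: "'v set"
  edges :: "'e set"
  ends :: "'e \<Rightarrow> 'v set"

definition finite_loopless_multigraph :: "('v, 'e) multigraph \<Rightarrow> bool" where
  "finite_loopless_multigraph G \<longleftrightarrow>
     finite (verts G) \<and> finite (edges G) \<and>
     (\<forall>e \<in> edges G. ends G e \<subseteq> verts G \<and> card (ends G e) = 2)"

definition incident_edges :: "('v, 'e) multigraph \<Rightarrow> 'v \<Rightarrow> 'e set" where
  "incident_edges G v = {e \<in> edges G. v \<in> ends G e}"

definition degree :: "('v, 'e) multigraph \<Rightarrow> 'v \<Rightarrow> nat" where
  "degree G v = card (incident_edges G v)"

fun is_walk :: "('v, 'e) multigraph \<Rightarrow> 'v list \<Rightarrow> 'e list \<Rightarrow> bool" where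
  "is_walk G [v] [] \<longleftrightarrow> v \<in> verts G"
| "is_walk G (u # v # vs) (e # es) \<longleftrightarrow>
     u \<in> verts G \<and> e \<in> edges G \<and> ends G e = {u, v} \<and> is_walk G (v # vs) es"
| "is_walk G _ _ \<longleftrightarrow> False"

definition is_path :: "('v, 'e) multigraph \<Rightarrow> 'v \<Rightarrow> 'v list \<Rightarrow> 'e list \<Rightarrow> 'v \<Rightarrow> bool" where
  "is_path G u vs es v \<longleftrightarrow> is_walk G vs es \<and> distinct vs \<and> hd vs = u \<and> last vs = v"

definition joined_by_edge_disjoint_paths :: "('v, 'e) multigraph \<Rightarrow> nat \<Rightarrow> 'v \<Rightarrow> 'v \<Rightarrow> bool" where
  "joined_by_edge_disjoint_paths G k u v \<longleftrightarrow>
     (\<exists>(vs :: nat \<Rightarrow> 'v list) (es :: nat \<Rightarrow> 'e list).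
        (\<forall>i < k. is_path G u (vs i) (es i) v) \<and>
        (\<forall>i < k. \<forall>j < k. i \<noteq> j \<longrightarrow> set (es i) \<inter> set (es j) = {}))"

definition sk_edge_connected :: "('v, 'e) multigraph \<Rightarrow> 'v \<Rightarrow> nat \<Rightarrow> bool" where
  "sk_edge_connected G s k \<longleftrightarrow>
     finite_loopless_multigraph G \<and> card (verts G) \<ge> 3 \<and> s \<in> verts G \<and> k > 0 \<and>
     (\<forall>u \<in> verts G - {s}. \<forall>v \<in> verts G - {s}. u \<noteq> v \<longrightarrow> joined_by_edge_disjoint_paths G k u v)"

definition other_end :: "('v, 'e) multigraph \<Rightarrow> 'v \<Rightarrow> 'e \<Rightarrow> 'v" where
  "other_end G s e = the_elem (ends G e - {s})"

text \<open>When the other ends \<open>v\<close>, \<open>w\<close> of \<open>e\<close>, \<open>f\<close> differ, the new edge \<open>vw\<close> reuses the name \<open>e\<close>, which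
  has just been freed. Exchanging \<open>e\<close> and \<open>f\<close> only renames an edge of the result.\<close>

definition lift_pair :: "('v, 'e) multigraph \<Rightarrow> 'v \<Rightarrow> 'e \<Rightarrow> 'e \<Rightarrow> ('v, 'e) multigraph" where
  "lift_pair G s e f =
     (let v = other_end G s e; w = other_end G s f
      in if v = w then G\<lparr>edges := edges G - {e, f}\<rparr>
         else G\<lparr>edges := insert e (edges G - {e, f}), ends := (ends G)(e := {v, w})\<rparr>)"

definition liftable_pair :: "('v, 'e) multigraph \<Rightarrow> 'v \<Rightarrow> nat \<Rightarrow> 'e \<Rightarrow> 'e \<Rightarrow> bool" where
  "liftable_pair G s k e f \<longleftrightarrow>
     e \<in> incident_edges G s \<and> f \<in> incident_edges G s \<and> e \<noteq> f \<and>
     sk_edge_connected (lift_pair G s e f) s k"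

text \<open>A simple graph is a pair of a vertex set and a set of two-element sets of vertices.\<close>

type_synonym 'a sgraph = "'a set \<times> 'a set set"

definition lifting_graph :: "('v, 'e) multigraph \<Rightarrow> 'v \<Rightarrow> nat \<Rightarrow> 'e sgraph" where
  "lifting_graph G s k = (incident_edges G s, {{e, f} | e f. liftable_pair G s k e f})"

definition independent_set :: "'a sgraph \<Rightarrow> 'a set \<Rightarrow> bool" where
  "independent_set L I \<longleftrightarrow> I \<subseteq> fst L \<and> (\<forall>x \<in> I. \<forall>y \<in> I. {x, y} \<notin> snd L)"

definition maximal_independent_set :: "'a sgraph \<Rightarrow> 'a set \<Rightarrow> bool" where
  "maximal_independent_set L I \<longleftrightarrow>
     independent_set L I \<and> (\<forall>J. independent_set L J \<and> I \<subseteq> J \<longrightarrow> J = I)"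

definition complete_multipartite :: "'a sgraph \<Rightarrow> bool" where
  "complete_multipartite L \<longleftrightarrow>
     (\<exists>P. partition_on (fst L) P \<and>
          snd L = {{x, y} | x y. \<exists>p \<in> P. \<exists>q \<in> P. p \<noteq> q \<and> x \<in> p \<and> y \<in> q})"

definition star :: "'a sgraph \<Rightarrow> bool" where
  "star L \<longleftrightarrow> (\<exists>c \<in> fst L. snd L = {{c, x} | x. x \<in> fst L - {c}})"

definition balanced_complete_bipartite :: "'a sgraph \<Rightarrow> bool" where
  "balanced_complete_bipartite L \<longleftrightarrow>
     (\<exists>A B. finite A \<and> finite B \<and> A \<inter> B = {} \<and> card A = card B \<and>
            fst L = A \<union> B \<and> snd L = {{a, b} | a b. a \<in> A \<and> b \<in> B})"

definition isolated_vertex_plus :: "'a sgraph \<Rightarrow> 'a \<Rightarrow> 'a sgraph \<Rightarrow> bool" where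
  "isolated_vertex_plus L z H \<longleftrightarrow> z \<notin> fst H \<and> L = (insert z (fst H), snd H)"

end

theory Submission
  imports Defs
begin

text \<open>By Menger's theorem a pair of edges at \<open>s\<close> fails to be liftable exactly when both other ends lie
  in a dangerous set: a nonempty proper subset \<open>X\<close> of \<open>U = V - {s}\<close> with \<open>d(X) \<le> k + 1\<close>. Comparing \<open>X\<close>
  with \<open>U - X\<close> shows that a dangerous set receives at most \<open>(deg s + 1) / 2\<close> edges from \<open>s\<close>.
  If two dangerous sets cross and share an edge at \<open>s\<close>, then
  \<open>d(X) + d(Y) \<ge> d(X - Y) + d(Y - X) + 2 d(X \<inter> Y, s)\<close> is tight, so they share exactly one such edge,
  \<open>d(X) = d(Y) = k + 1\<close> and \<open>d(X - Y) = d(Y - X) = k\<close>. If moreover \<open>X \<union> Y = U\<close>, this forces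
  \<open>deg s\<close> to be odd; otherwise \<open>d(X \<union> Y) \<le> k + 2\<close>, and \<open>d(X \<inter> Y)\<close> is odd, so that \<open>X \<union> Y\<close> is
  dangerous when \<open>k\<close> is even. The key step is that three pairwise non-liftable edges lie in a common
  dangerous set: three dangerous sets, each containing exactly two of the edges, contradict three
  submodularity-type inequalities. Hence every maximal independent set with at least two elements is
  the set of edges from \<open>s\<close> into one dangerous set.\<close>

section \<open>Menger's theorem\<close>

fun arc_walk :: "('e \<times> 'v \<times> 'v) set \<Rightarrow> 'v \<Rightarrow> ('e \<times> 'v \<times> 'v) list \<Rightarrow> 'v \<Rightarrow> bool" where
  "arc_walk A x [] y \<longleftrightarrow> x = y"
| "arc_walk A x ((e, a, b) # p) y \<longleftrightarrow> a = x \<and> (e, a, b) \<in> A \<and> arc_walk A b p y"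

abbreviation heads :: "('e \<times> 'v \<times> 'v) list \<Rightarrow> 'v list" where
  "heads p \<equiv> map (\<lambda>a. snd (snd a)) p"

definition step_rel :: "('e \<times> 'v \<times> 'v) set \<Rightarrow> ('v \<times> 'v) set" where
  "step_rel A = {(a, b). \<exists>e. (e, a, b) \<in> A}"

lemma arc_walk_append:
  "arc_walk A x (p @ q) y \<longleftrightarrow> (\<exists>z. arc_walk A x p z \<and> arc_walk A z q y)"
  by (induction A x p y rule: arc_walk.induct) auto

lemma arc_walk_vertices:
  "arc_walk A x p y \<Longrightarrow> (e, a, b) \<in> set p \<Longrightarrow>
     (e, a, b) \<in> A \<and> a \<in> set (x # heads p) \<and> b \<in> set (heads p)"
  by (induction A x p y rule: arc_walk.induct) auto

lemma arc_walk_mono: "arc_walk A x p y \<Longrightarrow> set p \<subseteq> B \<Longrightarrow> arc_walk B x p y"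
  by (induction A x p y rule: arc_walk.induct) auto

lemma last_heads: "arc_walk A x p y \<Longrightarrow> last (x # heads p) = y"
  by (induction A x p y rule: arc_walk.induct) auto

text \<open>Arcs are prepended one at a time. If the new first vertex already lies on the walk,
  everything up to that visit is cut off.\<close>

lemma simple_arc_walk_exists:
  assumes "(x, y) \<in> (step_rel A)\<^sup>*"
  shows "\<exists>p. arc_walk A x p y \<and> distinct (x # heads p)"
  using assms
proof (induction rule: converse_rtrancl_induct)
  case base
  show ?case by (rule exI[of _ "[]"]) simp
next
  case (step x x')
  then obtain e p where e: "(e, x, x') \<in> A" and p: "arc_walk A x' p y" "distinct (x' # heads p)"
    by (auto simp: step_rel_def)
  consider "x \<notin> set (x' # heads p)" | "x = x'" | "x \<in> set (heads p)" by auto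
  then show ?case
  proof cases
    case 1
    with e p have "arc_walk A x ((e, x, x') # p) y \<and> distinct (x # heads ((e, x, x') # p))" by auto
    then show ?thesis by blast
  next
    case 2
    with p show ?thesis by blast
  next
    case 3
    then obtain e' a where "(e', a, x) \<in> set p" by auto
    then obtain q r where "p = q @ (e', a, x) # r" by (meson split_list)
    with p have "arc_walk A x r y \<and> distinct (x # heads r)" by (auto simp: arc_walk_append)
    then show ?thesis by blast
  qed
qed

section \<open>Unit flows as partial orientations, and their augmentation\<close>

definition partial_orientation :: "('v, 'e) multigraph \<Rightarrow> ('e \<times> 'v \<times> 'v) set \<Rightarrow> bool" where
  "partial_orientation G F \<longleftrightarrow>
     (\<forall>e x y. (e, x, y) \<in> F \<longrightarrow> e \<in> edges G \<and> ends G e = {x, y}) \<and> inj_on fst F"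

text \<open>Outflow minus inflow at \<open>w\<close> when each arc of \<open>F\<close> carries one
  unit. Injectivity of \<open>fst\<close> in \<open>partial_orientation\<close> gives every edge
  capacity one, in one direction at a time.\<close>

definition net :: "('e \<times> 'v \<times> 'v) set \<Rightarrow> 'v \<Rightarrow> int" where
  "net F w = (\<Sum>(e, x, y) \<in> F. of_bool (x = w) - of_bool (y = w))"

definition residual :: "('v, 'e) multigraph \<Rightarrow> ('e \<times> 'v \<times> 'v) set \<Rightarrow> ('e \<times> 'v \<times> 'v) set" where
  "residual G F = {(e, x, y). e \<in> edges G \<and> ends G e = {x, y} \<and> (e \<notin> fst ` F \<or> (e, y, x) \<in> F)}"

definition edge_cut :: "('v, 'e) multigraph \<Rightarrow> 'v set \<Rightarrow> 'e set" where
  "edge_cut G X = {e \<in> edges G. ends G e \<inter> X \<noteq> {} \<and> \<not> ends G e \<subseteq> X}"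

lemma ends_obtain:
  assumes "finite_loopless_multigraph G" "e \<in> edges G"
  obtains x y where "ends G e = {x, y}" "x \<noteq> y" "x \<in> verts G" "y \<in> verts G"
proof -
  from assms have "card (ends G e) = 2" "ends G e \<subseteq> verts G" 
    by (auto simp: finite_loopless_multigraph_def)
  then show ?thesis using that by (auto simp: card_2_iff)
qed

lemma partial_orientation_finite:
  assumes "finite_loopless_multigraph G" "partial_orientation G F"
  shows "finite F"
proof (rule finite_imageD[of fst])
  have "fst ` F \<subseteq> edges G" using assms(2) by (auto simp: partial_orientation_def)
  then show "finite (fst ` F)"
    using assms(1) by (auto simp: finite_loopless_multigraph_def intro: finite_subset)
qed (use assms(2) in \<open>auto simp: partial_orientation_def\<close>)

lemma net_insert:
  "finite F \<Longrightarrow> (e, x, y) \<notin> F \<Longrightarrow>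
     net (insert (e, x, y) F) w = net F w + of_bool (x = w) - of_bool (y = w)"
  by (simp add: net_def)

lemma net_Diff: "finite F \<Longrightarrow> P \<subseteq> F \<Longrightarrow> net (F - P) w = net F w - net P w"
  by (simp add: net_def sum_diff)

text \<open>After exchanging the two sums, an arc contributes only at its ends, so arcs inside
  \<open>R\<close> cancel and the flow across the boundary of \<open>R\<close> remains.\<close>

lemma sum_net:
  assumes "finite R"
  shows "(\<Sum>w\<in>R. net F w) = (\<Sum>(e, x, y) \<in> F. of_bool (x \<in> R) - of_bool (y \<in> R))"
proof -
  have "(\<Sum>w\<in>R. net F w) = (\<Sum>a\<in>F. \<Sum>w\<in>R. of_bool (fst (snd a) = w) - of_bool (snd (snd a) = w))"
    unfolding net_def by (subst sum.swap) (simp add: case_prod_beta)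
  also have "\<dots> = (\<Sum>a\<in>F. of_bool (fst (snd a) \<in> R) - of_bool (snd (snd a) \<in> R))"
    using assms by (intro sum.cong refl) (simp add: sum_subtractf of_bool_def)
  finally show ?thesis by (simp add: case_prod_beta)
qed

text \<open>The unit either cancels the opposite arc of \<open>F\<close> or adds a new arc. The
  third conclusion confines the change to the edge \<open>e\<close>, so that residual arcs on other
  edges survive.\<close>

lemma push_arc:
  assumes "finite_loopless_multigraph G" "partial_orientation G F" "(e, x, y) \<in> residual G F"
  obtains F' where "partial_orientation G F'"
    "\<And>w. net F' w = net F w + of_bool (x = w) - of_bool (y = w)"
    "\<And>a b c. a \<noteq> e \<Longrightarrow> (a, b, c) \<in> F' \<longleftrightarrow> (a, b, c) \<in> F"
proof (cases "(e, y, x) \<in> F")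
  case True
  let ?F' = "F - {(e, y, x)}"
  have "finite F" using assms partial_orientation_finite by blast
  then have "net ?F' w = net F w + of_bool (x = w) - of_bool (y = w)" for w
    using True by (subst net_Diff) (auto simp: net_def)
  moreover have "partial_orientation G ?F'"
    using assms(2) by (auto simp: partial_orientation_def inj_on_diff)
  ultimately show ?thesis using that[of ?F'] by auto
next
  case False
  let ?F' = "insert (e, x, y) F"
  have e: "e \<notin> fst ` F" "e \<in> edges G" "ends G e = {x, y}"
    using False assms(3) by (auto simp: residual_def)
  have "finite F" using assms partial_orientation_finite by blast
  moreover have "(e, x, y) \<notin> F" using e by force
  ultimately have "net ?F' w = net F w + of_bool (x = w) - of_bool (y = w)" for w
    using net_insert by metis
  moreover have "partial_orientation G ?F'"
    using assms(2) e by (auto simp: partial_orientation_def)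
  ultimately show ?thesis using that[of ?F'] by auto
qed

text \<open>Every arc on \<open>e\<close> has \<open>x\<close> as an end, and the walk from
  \<open>b\<close> never visits \<open>x\<close>. In \<open>augment\<close> this keeps the remaining
  arcs residual once the first one has been pushed.\<close>

lemma arc_walk_tail_avoids_start:
  assumes "arc_walk A b p y" "x \<notin> set (b # heads p)" "(e', c, d) \<in> set p"
    "\<And>e c d. (e, c, d) \<in> A \<Longrightarrow> ends G e = {c, d}" "ends G e = {x, b}"
  shows "e' \<noteq> e"
  using arc_walk_vertices[OF assms(1,3)] assms(2,4,5) by (metis doubleton_eq_iff list.set_intros(2))

lemma augment:
  assumes "finite_loopless_multigraph G" "partial_orientation G F"
    "arc_walk (residual G F) x p y" "distinct (x # heads p)"
  shows "\<exists>F'. partial_orientation G F' \<and>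
           (\<forall>w. net F' w = net F w + of_bool (x = w) - of_bool (y = w))"
  using assms(2-)
proof (induction p arbitrary: F x)
  case Nil
  then show ?case by auto
next
  case (Cons a p)
  obtain e b where a: "a = (e, x, b)" using Cons.prems(2) by (cases a) auto
  have res: "(e, x, b) \<in> residual G F" and p: "arc_walk (residual G F) b p y"
    using Cons.prems(2) a by auto
  obtain F' where F': "partial_orientation G F'"
    "\<And>w. net F' w = net F w + of_bool (x = w) - of_bool (b = w)"
    "\<And>a b c. a \<noteq> e \<Longrightarrow> (a, b, c) \<in> F' \<longleftrightarrow> (a, b, c) \<in> F"
    using push_arc[OF assms(1) Cons.prems(1) res] by metis
  have "set p \<subseteq> residual G F'"
  proof
    fix t assume t: "t \<in> set p"
    obtain e' c d where t': "t = (e', c, d)" by (cases t)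
    have "e' \<noteq> e"
      by (rule arc_walk_tail_avoids_start[OF p])
        (use Cons.prems(3) a t t' res in \<open>auto simp: residual_def\<close>)
    moreover have "(e', c, d) \<in> residual G F" using arc_walk_vertices p t t' by metis
    ultimately show "t \<in> residual G F'"
      using F'(3) t' by (force simp: residual_def)
  qed
  then have "arc_walk (residual G F') b p y" using p arc_walk_mono by metis
  moreover have "distinct (b # heads p)" using Cons.prems(3) a by auto
  ultimately obtain F'' where "partial_orientation G F''"
    "\<forall>w. net F'' w = net F' w + of_bool (b = w) - of_bool (y = w)"
    using Cons.IH F'(1) by blast
  then show ?case using F'(2) by auto
qed

lemma sum_net_flow:
  assumes "finite R" "u \<in> R" "v \<notin> R"
    "\<And>w. net F w = int j * (of_bool (u = w) - of_bool (v = w))"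
  shows "(\<Sum>(e, x, y) \<in> F. of_bool (x \<in> R) - of_bool (y \<in> R)) = int j"
proof -
  have "(\<Sum>w\<in>R. net F w) = (\<Sum>w\<in>R. if u = w then int j else 0)"
    using assms by (intro sum.cong) auto
  then show ?thesis using sum_net[OF assms(1), of F] assms(1,2) by simp
qed

lemma reachable_subset_verts:
  assumes "finite_loopless_multigraph G" "u \<in> verts G"
    "\<And>e x y. (e, x, y) \<in> A \<Longrightarrow> e \<in> edges G \<and> ends G e = {x, y}"
  shows "{w. (u, w) \<in> (step_rel A)\<^sup>*} \<subseteq> verts G"
proof
  fix w assume "w \<in> {w. (u, w) \<in> (step_rel A)\<^sup>*}"
  then have "(u, w) \<in> (step_rel A)\<^sup>*" by simp
  then show "w \<in> verts G"
    by (induction rule: rtrancl_induct)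
      (use assms in \<open>force simp: step_rel_def finite_loopless_multigraph_def\<close>)+
qed

text \<open>The value grows by one unit per augmentation. If \<open>v\<close> is not residually
  reachable from \<open>u\<close>, the flow uses every edge in the cut of the reachable set
  \<open>R\<close> outwards and none inwards, so this cut has at most \<open>j\<close> edges, fewer
  than \<open>k\<close>.\<close>

lemma flow_exists:
  assumes G: "finite_loopless_multigraph G" and uv: "u \<in> verts G" "v \<in> verts G" "u \<noteq> v"
    and cuts: "\<And>X. X \<subseteq> verts G \<Longrightarrow> u \<in> X \<Longrightarrow> v \<notin> X \<Longrightarrow> k \<le> card (edge_cut G X)"
  shows "j \<le> k \<Longrightarrow> \<exists>F. partial_orientation G F \<and>
           (\<forall>w. net F w = int j * (of_bool (u = w) - of_bool (v = w)))"
proof (induction j)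
  case 0
  show ?case by (rule exI[of _ "{}"]) (auto simp: partial_orientation_def net_def)
next
  case (Suc j)
  then obtain F where F: "partial_orientation G F"
    "\<And>w. net F w = int j * (of_bool (u = w) - of_bool (v = w))" by auto
  define R where "R = {w. (u, w) \<in> (step_rel (residual G F))\<^sup>*}"
  have finF: "finite F" using G F(1) partial_orientation_finite by blast
  have F_ends: "e \<in> edges G \<and> ends G e = {x, y}" if "(e, x, y) \<in> F" for e x y
    using F(1) that by (auto simp: partial_orientation_def)
  have "v \<in> R"
  proof (rule ccontr)
    assume v: "v \<notin> R"
    have RV: "R \<subseteq> verts G" unfolding R_def
      by (rule reachable_subset_verts[OF G uv(1)]) (auto simp: residual_def)
    then have finR: "finite R"
      using G by (auto simp: finite_loopless_multigraph_def intro: finite_subset)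
    have u: "u \<in> R" by (simp add: R_def)
    have closed: "y \<in> R" if "(e, x, y) \<in> residual G F" "x \<in> R" for e x y
      using that unfolding R_def step_rel_def by (auto intro: rtrancl_into_rtrancl)
    have no_in: "x \<in> R" if "(e, x, y) \<in> F" "y \<in> R" for e x y
    proof -
      have "(e, y, x) \<in> residual G F"
        using that F_ends by (auto simp: residual_def insert_commute)
      then show ?thesis using closed that by blast
    qed
    define Out where "Out = {a \<in> F. fst (snd a) \<in> R \<and> snd (snd a) \<notin> R}"
    have "edge_cut G R \<subseteq> fst ` Out"
    proof
      fix e assume "e \<in> edge_cut G R"
      then have e: "e \<in> edges G" "ends G e \<inter> R \<noteq> {}" "\<not> ends G e \<subseteq> R" by (auto simp: edge_cut_def)
      then obtain x y where xy: "ends G e = {x, y}" "x \<in> R" "y \<notin> R"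
        by (rule_tac ends_obtain[OF G e(1)]) (auto simp: insert_commute)
      \<comment> \<open>Since \<open>R\<close> is closed under residual arcs, the edge
        \<open>e\<close> is in use, and not from \<open>y\<close> to \<open>x\<close>; hence it
        carries a unit out of \<open>R\<close>.\<close>
      have "(e, x, y) \<notin> residual G F" using closed xy by blast
      then have "e \<in> fst ` F" "(e, y, x) \<notin> F" using e xy by (auto simp: residual_def)
      then obtain a b where ab: "(e, a, b) \<in> F" by force
      then have "{a, b} = {x, y}" using F_ends xy by metis
      then have "(e, x, y) \<in> F" using ab \<open>(e, y, x) \<notin> F\<close> by (auto simp: doubleton_eq_iff)
      then show "e \<in> fst ` Out" using xy by (force simp: Out_def)
    qed
    then have "card (edge_cut G R) \<le> card Out"
      using finF by (intro surj_card_le) (auto simp: Out_def)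
    moreover have "int (card Out) = int j"
    proof -
      have "int j = (\<Sum>a\<in>F. of_bool (fst (snd a) \<in> R) - of_bool (snd (snd a) \<in> R))"
        using sum_net_flow[OF finR u v F(2)] by (simp add: case_prod_beta)
      also have "\<dots> = (\<Sum>a\<in>F. if fst (snd a) \<in> R \<and> snd (snd a) \<notin> R then 1 else 0)"
        by (rule sum.cong) (auto dest: no_in)
      also have "\<dots> = int (card Out)"
        unfolding Out_def using finF by (simp add: sum.If_cases Int_def)
      finally show ?thesis by simp
    qed
    ultimately show False using cuts[OF RV u v] Suc.prems by simp
  qed
  then have "(u, v) \<in> (step_rel (residual G F))\<^sup>*" by (simp add: R_def)
  from simple_arc_walk_exists[OF this]
  obtain p where p: "arc_walk (residual G F) u p v" "distinct (u # heads p)" by blast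
  obtain F' where "partial_orientation G F'"
    "\<forall>w. net F' w = net F w + of_bool (u = w) - of_bool (v = w)"
    using augment[OF G F(1) p] by blast
  moreover from this have "net F' w = int (Suc j) * (of_bool (u = w) - of_bool (v = w))" for w
    using F(2)[of w] by (cases "u = w"; cases "v = w") auto
  ultimately show ?case by blast
qed

section \<open>Edge-disjoint paths from a flow\<close>

lemma arc_walk_is_walk:
  assumes "finite_loopless_multigraph G" "partial_orientation G F"
  shows "arc_walk F x p y \<Longrightarrow> x \<in> verts G \<Longrightarrow> is_walk G (x # heads p) (map fst p)"
proof (induction p arbitrary: x)
  case (Cons a p)
  obtain e b where a: "a = (e, x, b)" using Cons.prems(1) by (cases a) auto
  then have "e \<in> edges G" "ends G e = {x, b}"
    using Cons.prems assms(2) by (auto simp: partial_orientation_def)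
  moreover from this have "b \<in> verts G" using assms(1) by (auto simp: finite_loopless_multigraph_def)
  ultimately show ?case using Cons a by auto
qed simp

text \<open>The contributions telescope; distinct vertices make the arcs distinct, so passing from
  the list to its set loses none of them.\<close>

lemma net_simple_walk:
  "arc_walk F x p y \<Longrightarrow> distinct (x # heads p) \<Longrightarrow>
     net (set p) w = of_bool (x = w) - of_bool (y = w)"
proof (induction p arbitrary: x)
  case Nil
  then show ?case by (simp add: net_def)
next
  case (Cons a p)
  obtain e b where a: "a = (e, x, b)" using Cons.prems(1) by (cases a) auto
  have "(e, x, b) \<notin> set p" using Cons.prems a by force
  then have "net (set (a # p)) w = net (set p) w + of_bool (x = w) - of_bool (b = w)"
    using net_insert[of "set p"] a by simp
  then show ?case using Cons a by auto
qed

text \<open>One path is peeled off at a time. If \<open>v\<close> were not reachable along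
  \<open>F\<close>, no arc would leave the reachable set, although its net outflow is positive.
  Keeping the paths within the edges of \<open>F\<close> carries disjointness through the
  induction.\<close>

lemma flow_decomposition:
  assumes G: "finite_loopless_multigraph G" and uv: "u \<in> verts G" "u \<noteq> v"
  shows "partial_orientation G F \<Longrightarrow>
     (\<And>w. net F w = int j * (of_bool (u = w) - of_bool (v = w))) \<Longrightarrow>
     \<exists>vs es. (\<forall>i<j. is_path G u (vs i) (es i) v \<and> set (es i) \<subseteq> fst ` F) \<and>
             (\<forall>i<j. \<forall>i'<j. i \<noteq> i' \<longrightarrow> set (es i) \<inter> set (es i') = {})"
proof (induction j arbitrary: F)
  case (Suc j)
  note F = Suc.prems
  define R where "R = {w. (u, w) \<in> (step_rel F)\<^sup>*}"
  have finF: "finite F" using G F(1) partial_orientation_finite by blast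
  have "v \<in> R"
  proof (rule ccontr)
    assume v: "v \<notin> R"
    have "R \<subseteq> verts G" unfolding R_def
      by (rule reachable_subset_verts[OF G uv(1)]) (use F(1) in \<open>auto simp: partial_orientation_def\<close>)
    then have finR: "finite R"
      using G by (auto simp: finite_loopless_multigraph_def intro: finite_subset)
    have u: "u \<in> R" by (simp add: R_def)
    have "y \<in> R" if "(e, x, y) \<in> F" "x \<in> R" for e x y
      using that unfolding R_def step_rel_def by (auto intro: rtrancl_into_rtrancl)
    then have "(\<Sum>(e, x, y) \<in> F. of_bool (x \<in> R) - of_bool (y \<in> R)) \<le> (0 :: int)"
      by (intro sum_nonpos) auto
    then show False using sum_net_flow[OF finR u v F(2)] by simp
  qed
  then have "(u, v) \<in> (step_rel F)\<^sup>*" by (simp add: R_def)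
  from simple_arc_walk_exists[OF this]
  obtain p where p: "arc_walk F u p v" "distinct (u # heads p)" by blast
  have pF: "set p \<subseteq> F" using arc_walk_vertices[OF p(1)] by auto
  let ?F' = "F - set p"
  have po: "partial_orientation G ?F'"
    using F(1) by (auto simp: partial_orientation_def inj_on_diff)
  have "net ?F' w = int j * (of_bool (u = w) - of_bool (v = w))" for w
    using net_Diff[OF finF pF, of w] net_simple_walk[OF p, of w] F(2)[of w]
    by (cases "u = w"; cases "v = w") auto
  from Suc.IH[OF po this] obtain vs es where IH:
    "\<forall>i<j. is_path G u (vs i) (es i) v \<and> set (es i) \<subseteq> fst ` ?F'"
    "\<forall>i<j. \<forall>i'<j. i \<noteq> i' \<longrightarrow> set (es i) \<inter> set (es i') = {}" by blast
  \<comment> \<open>Injectivity of \<open>fst\<close> on \<open>F\<close> turns disjointness of arcs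
    into disjointness of edge names.\<close>
  have disj: "fst ` ?F' \<inter> fst ` set p = {}"
    using F(1) pF unfolding partial_orientation_def inj_on_def by blast
  have path: "is_path G u (u # heads p) (map fst p) v"
    unfolding is_path_def using arc_walk_is_walk[OF G F(1) p(1) uv(1)] p last_heads[OF p(1)] by simp
  let ?vs = "vs(j := u # heads p)" and ?es = "es(j := map fst p)"
  have "\<forall>i<Suc j. is_path G u (?vs i) (?es i) v \<and> set (?es i) \<subseteq> fst ` F"
    using IH(1) path pF by (auto simp: less_Suc_eq)
  moreover have "set (es i) \<inter> set (map fst p) = {}" if "i < j" for i
    using IH(1) that disj by auto
  then have "\<forall>i<Suc j. \<forall>i'<Suc j. i \<noteq> i' \<longrightarrow> set (?es i) \<inter> set (?es i') = {}"
    using IH(2) by (auto simp: less_Suc_eq) 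
  ultimately show ?case by blast
qed simp

lemma menger:
  assumes "finite_loopless_multigraph G" "u \<in> verts G" "v \<in> verts G" "u \<noteq> v"
    and "\<And>X. X \<subseteq> verts G \<Longrightarrow> u \<in> X \<Longrightarrow> v \<notin> X \<Longrightarrow> k \<le> card (edge_cut G X)"
  shows "joined_by_edge_disjoint_paths G k u v"
proof -
  obtain F where "partial_orientation G F"
    "\<forall>w. net F w = int k * (of_bool (u = w) - of_bool (v = w))"
    using flow_exists[OF assms order_refl] by blast
  then show ?thesis
    using flow_decomposition[OF assms(1,2,4), of F k]
    unfolding joined_by_edge_disjoint_paths_def by blast
qed

section \<open>Paths against cuts\<close>

lemma walk_crosses_cut:
  "is_walk G vs es \<Longrightarrow> hd vs \<in> X \<Longrightarrow> last vs \<notin> X \<Longrightarrow> set es \<inter> edge_cut G X \<noteq> {}"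
proof (induction G vs es rule: is_walk.induct)
  case (2 G u v vs e es)
  then show ?case by (cases "v \<in> X") (auto simp: edge_cut_def)
qed auto

text \<open>Choosing a cut edge on each path is injective because the paths share no edge.\<close>

lemma edge_disjoint_paths_cut:
  assumes "finite_loopless_multigraph G" "joined_by_edge_disjoint_paths G k u v" "u \<in> X" "v \<notin> X"
  shows "k \<le> card (edge_cut G X)"
proof -
  obtain vs es where p: "\<And>i. i < k \<Longrightarrow> is_path G u (vs i) (es i) v"
    and disj: "\<And>i j. i < k \<Longrightarrow> j < k \<Longrightarrow> i \<noteq> j \<Longrightarrow> set (es i) \<inter> set (es j) = {}"
    using assms(2) unfolding joined_by_edge_disjoint_paths_def by metis
  have "\<forall>i<k. \<exists>e. e \<in> set (es i) \<inter> edge_cut G X"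
    using p walk_crosses_cut assms(3,4) unfolding is_path_def by (metis ex_in_conv)
  then obtain c where c: "\<And>i. i < k \<Longrightarrow> c i \<in> set (es i) \<inter> edge_cut G X" by metis
  have "inj_on c {..<k}" using c disj by (fastforce simp: inj_on_def)
  moreover have "c ` {..<k} \<subseteq> edge_cut G X" using c by auto
  moreover have "finite (edge_cut G X)"
    using assms(1) by (simp add: edge_cut_def finite_loopless_multigraph_def)
  ultimately show ?thesis using card_inj_on_le[of c "{..<k}"] by simp
qed

section \<open>Cut inequalities\<close>

definition edges_into :: "('v, 'e) multigraph \<Rightarrow> 'v \<Rightarrow> 'v set \<Rightarrow> 'e set" where
  "edges_into G s X = {e \<in> incident_edges G s. ends G e \<inter> X \<noteq> {}}"

lemma card_filter_eq_sum: "finite E \<Longrightarrow> int (card {e \<in> E. P e}) = (\<Sum>e\<in>E. of_bool (P e))"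
  by (simp add: of_bool_def sum.If_cases Int_def)

lemma card_edge_cut:
  assumes "finite_loopless_multigraph G"
  shows "int (card (edge_cut G X)) =
    (\<Sum>e\<in>edges G. of_bool (ends G e \<inter> X \<noteq> {} \<and> \<not> ends G e \<subseteq> X))"
  using assms unfolding edge_cut_def
  by (intro card_filter_eq_sum) (simp add: finite_loopless_multigraph_def)

lemma card_edges_into:
  assumes "finite_loopless_multigraph G"
  shows "int (card (edges_into G s X)) =
    (\<Sum>e\<in>edges G. of_bool (s \<in> ends G e \<and> ends G e \<inter> X \<noteq> {}))"
proof -
  have "edges_into G s X = {e \<in> edges G. s \<in> ends G e \<and> ends G e \<inter> X \<noteq> {}}"
    by (auto simp: edges_into_def incident_edges_def)
  then show ?thesis
    using assms card_filter_eq_sum[of "edges G"] by (simp add: finite_loopless_multigraph_def)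
qed

lemma degree_eq_sum:
  assumes "finite_loopless_multigraph G"
  shows "int (degree G s) = (\<Sum>e\<in>edges G. of_bool (s \<in> ends G e))"
  using assms unfolding degree_def incident_edges_def
  by (intro card_filter_eq_sum) (simp add: finite_loopless_multigraph_def)

lemma edge_cut_complement:
  assumes "finite_loopless_multigraph G"
  shows "edge_cut G (verts G - X) = edge_cut G X"
proof -
  have "ends G e \<subseteq> verts G" if "e \<in> edges G" for e
    using assms that by (simp add: finite_loopless_multigraph_def)
  then show ?thesis unfolding edge_cut_def by blast
qed

text \<open>With every count written as a sum over all edges, a cut inequality reduces to a check
  for one edge, by the position of its two ends.\<close>

lemmas count_sums = card_edge_cut card_edges_into degree_eq_sum

text \<open>An edge from \<open>s\<close> to \<open>X \<inter> Y\<close> lies in both cuts on the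
  right but in neither of the cuts of the differences; this pays for the term with factor 2.\<close>

lemma cut_posimodular:
  assumes G: "finite_loopless_multigraph G" and s: "s \<notin> X" "s \<notin> Y"
  shows "card (edge_cut G (X - Y)) + card (edge_cut G (Y - X)) + 2 * card (edges_into G s (X \<inter> Y))
    \<le> card (edge_cut G X) + card (edge_cut G Y)" (is "?l \<le> ?r")
proof -
  have "int ?l \<le> int ?r"
    unfolding of_nat_add of_nat_mult count_sums[OF G] sum_distrib_left sum.distrib[symmetric]
  proof (rule sum_mono)
    fix e assume "e \<in> edges G"
    then obtain a b where "ends G e = {a, b}" by (rule ends_obtain[OF G])
    then show "of_bool (ends G e \<inter> (X - Y) \<noteq> {} \<and> \<not> ends G e \<subseteq> X - Y) +
       of_bool (ends G e \<inter> (Y - X) \<noteq> {} \<and> \<not> ends G e \<subseteq> Y - X) +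
       int 2 * of_bool (s \<in> ends G e \<and> ends G e \<inter> (X \<inter> Y) \<noteq> {})
       \<le> of_bool (ends G e \<inter> X \<noteq> {} \<and> \<not> ends G e \<subseteq> X) +
       of_bool (ends G e \<inter> Y \<noteq> {} \<and> \<not> ends G e \<subseteq> Y)"
      using s by (cases "a \<in> X"; cases "a \<in> Y"; cases "b \<in> X"; cases "b \<in> Y") auto
  qed
  then show ?thesis by linarith
qed

lemma cut_submodular:
  assumes G: "finite_loopless_multigraph G"
  shows "card (edge_cut G (X \<inter> Y)) + card (edge_cut G (X \<union> Y))
    \<le> card (edge_cut G X) + card (edge_cut G Y)" (is "?l \<le> ?r")
proof -
  have "int ?l \<le> int ?r"
    unfolding of_nat_add of_nat_mult count_sums[OF G] sum_distrib_left sum.distrib[symmetric]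
  proof (rule sum_mono)
    fix e assume "e \<in> edges G"
    then obtain a b where "ends G e = {a, b}" by (rule ends_obtain[OF G])
    then show "of_bool (ends G e \<inter> (X \<inter> Y) \<noteq> {} \<and> \<not> ends G e \<subseteq> X \<inter> Y) +
       of_bool (ends G e \<inter> (X \<union> Y) \<noteq> {} \<and> \<not> ends G e \<subseteq> X \<union> Y)
       \<le> (of_bool (ends G e \<inter> X \<noteq> {} \<and> \<not> ends G e \<subseteq> X) +
       of_bool (ends G e \<inter> Y \<noteq> {} \<and> \<not> ends G e \<subseteq> Y) :: int)"
      by (cases "a \<in> X"; cases "a \<in> Y"; cases "b \<in> X"; cases "b \<in> Y") auto
  qed
  then show ?thesis by linarith
qed

text \<open>Within \<open>verts G - {s}\<close> both sets have the same boundary edges. The cuts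
  differ only in the edges at \<open>s\<close>, which are split between \<open>X\<close> and its
  complement.\<close>

lemma cut_complement_avoiding:
  assumes G: "finite_loopless_multigraph G" and X: "X \<subseteq> verts G - {s}"
  shows "card (edge_cut G (verts G - {s} - X)) + 2 * card (edges_into G s X) =
    card (edge_cut G X) + degree G s" (is "?l = ?r")
proof -
  have "int ?l = int ?r"
    unfolding of_nat_add of_nat_mult count_sums[OF G] sum_distrib_left sum.distrib[symmetric]
  proof (rule sum.cong)
    fix e assume "e \<in> edges G"
    then obtain a b where "ends G e = {a, b}" "a \<noteq> b" "a \<in> verts G" "b \<in> verts G"
      by (rule ends_obtain[OF G])
    then show "of_bool (ends G e \<inter> (verts G - {s} - X) \<noteq> {} \<and> \<not> ends G e \<subseteq> verts G - {s} - X) +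
       int 2 * of_bool (s \<in> ends G e \<and> ends G e \<inter> X \<noteq> {})
       = of_bool (ends G e \<inter> X \<noteq> {} \<and> \<not> ends G e \<subseteq> X) + of_bool (s \<in> ends G e)"
      using X by (cases "a \<in> X"; cases "b \<in> X"; cases "a = s"; cases "b = s") auto
  qed simp
  then show ?thesis by linarith
qed

text \<open>The sum of the cuts of \<open>A\<close> and \<open>B\<close> exceeds the cut of the
  union by twice the number of edges between \<open>A\<close> and \<open>B\<close>.\<close>

lemma cut_disjoint_union_parity:
  assumes G: "finite_loopless_multigraph G" and AB: "A \<inter> B = {}"
  shows "even (card (edge_cut G A) + card (edge_cut G B) + card (edge_cut G (A \<union> B)))" (is "even ?n")
proof -
  have "even (int ?n)"
    unfolding of_nat_add of_nat_mult count_sums[OF G] sum_distrib_left sum.distrib[symmetric]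
  proof (rule dvd_sum)
    fix e assume "e \<in> edges G"
    then obtain a b where "ends G e = {a, b}" by (rule ends_obtain[OF G])
    then show "even (of_bool (ends G e \<inter> A \<noteq> {} \<and> \<not> ends G e \<subseteq> A) +
       of_bool (ends G e \<inter> B \<noteq> {} \<and> \<not> ends G e \<subseteq> B) +
       of_bool (ends G e \<inter> (A \<union> B) \<noteq> {} \<and> \<not> ends G e \<subseteq> A \<union> B) :: int)"
      using AB by (cases "a \<in> A"; cases "a \<in> B"; cases "b \<in> A"; cases "b \<in> B") auto
  qed
  then show ?thesis by presburger
qed

text \<open>The two sides differ only by edges from the triple intersection to vertices in at most
  one of the sets, counted three times on the right and once on the left.\<close>

lemma cut_three_pairwise_intersections:
  assumes G: "finite_loopless_multigraph G"
  shows "card (edge_cut G (X \<inter> Y - Z)) + card (edge_cut G (X \<inter> Z - Y)) +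
      card (edge_cut G (Y \<inter> Z - X)) + card (edge_cut G (X \<inter> Y \<inter> Z))
    \<le> card (edge_cut G (X \<inter> Y)) + card (edge_cut G (X \<inter> Z)) + card (edge_cut G (Y \<inter> Z))"
    (is "?l \<le> ?r")
proof -
  have "int ?l \<le> int ?r"
    unfolding of_nat_add of_nat_mult count_sums[OF G] sum_distrib_left sum.distrib[symmetric]
  proof (rule sum_mono)
    fix e assume "e \<in> edges G"
    then obtain a b where "ends G e = {a, b}" by (rule ends_obtain[OF G])
    then show "of_bool (ends G e \<inter> (X \<inter> Y - Z) \<noteq> {} \<and> \<not> ends G e \<subseteq> X \<inter> Y - Z) +
       of_bool (ends G e \<inter> (X \<inter> Z - Y) \<noteq> {} \<and> \<not> ends G e \<subseteq> X \<inter> Z - Y) +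
       of_bool (ends G e \<inter> (Y \<inter> Z - X) \<noteq> {} \<and> \<not> ends G e \<subseteq> Y \<inter> Z - X) +
       of_bool (ends G e \<inter> (X \<inter> Y \<inter> Z) \<noteq> {} \<and> \<not> ends G e \<subseteq> X \<inter> Y \<inter> Z)
       \<le> (of_bool (ends G e \<inter> (X \<inter> Y) \<noteq> {} \<and> \<not> ends G e \<subseteq> X \<inter> Y) +
       of_bool (ends G e \<inter> (X \<inter> Z) \<noteq> {} \<and> \<not> ends G e \<subseteq> X \<inter> Z) +
       of_bool (ends G e \<inter> (Y \<inter> Z) \<noteq> {} \<and> \<not> ends G e \<subseteq> Y \<inter> Z) :: int)"
      by (cases "a \<in> X"; cases "a \<in> Y"; cases "a \<in> Z"; cases "b \<in> X"; cases "b \<in> Y"; cases "b \<in> Z")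
        simp_all
  qed
  then show ?thesis by linarith
qed

text \<open>A version of \<open>cut_posimodular\<close> for three sets: an edge from
  \<open>s\<close> into exactly two of them is counted twice on the right and lies in no cut on the
  left.\<close>

lemma cut_three_differences:
  assumes G: "finite_loopless_multigraph G" and s: "s \<notin> X" "s \<notin> Y" "s \<notin> Z"
  shows "card (edge_cut G (X - Y - Z)) + card (edge_cut G (Y - X - Z)) + card (edge_cut G (Z - X - Y)) +
      2 * card (edges_into G s (X \<inter> Y - Z)) + 2 * card (edges_into G s (X \<inter> Z - Y)) +
      2 * card (edges_into G s (Y \<inter> Z - X))
    \<le> card (edge_cut G X) + card (edge_cut G Y) + card (edge_cut G Z)" (is "?l \<le> ?r")
proof -
  have "int ?l \<le> int ?r"
    unfolding of_nat_add of_nat_mult count_sums[OF G] sum_distrib_left sum.distrib[symmetric]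
  proof (rule sum_mono)
    fix e assume "e \<in> edges G"
    then obtain a b where "ends G e = {a, b}" by (rule ends_obtain[OF G])
    then show "of_bool (ends G e \<inter> (X - Y - Z) \<noteq> {} \<and> \<not> ends G e \<subseteq> X - Y - Z) +
       of_bool (ends G e \<inter> (Y - X - Z) \<noteq> {} \<and> \<not> ends G e \<subseteq> Y - X - Z) +
       of_bool (ends G e \<inter> (Z - X - Y) \<noteq> {} \<and> \<not> ends G e \<subseteq> Z - X - Y) +
       int 2 * of_bool (s \<in> ends G e \<and> ends G e \<inter> (X \<inter> Y - Z) \<noteq> {}) +
       int 2 * of_bool (s \<in> ends G e \<and> ends G e \<inter> (X \<inter> Z - Y) \<noteq> {}) +
       int 2 * of_bool (s \<in> ends G e \<and> ends G e \<inter> (Y \<inter> Z - X) \<noteq> {})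
       \<le> of_bool (ends G e \<inter> X \<noteq> {} \<and> \<not> ends G e \<subseteq> X) +
       of_bool (ends G e \<inter> Y \<noteq> {} \<and> \<not> ends G e \<subseteq> Y) +
       of_bool (ends G e \<inter> Z \<noteq> {} \<and> \<not> ends G e \<subseteq> Z)"
      using s
      by (cases "a \<in> X"; cases "a \<in> Y"; cases "a \<in> Z"; cases "b \<in> X"; cases "b \<in> Y"; cases "b \<in> Z")
        (auto split: if_splits)
  qed
  then show ?thesis by linarith
qed

text \<open>Here \<open>X\<close> splits into \<open>X \<inter> Y\<close>, which lies in
  \<open>Y - Z\<close>, and \<open>X \<inter> Z\<close>, which lies in \<open>Z - Y\<close>.
  Splitting costs twice the edges between the two parts, and submodularity for \<open>Y\<close> and
  \<open>Z\<close> has slack twice the edges between \<open>Y - Z\<close> and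
  \<open>Z - Y\<close>.\<close>

lemma cut_three_covered:
  assumes G: "finite_loopless_multigraph G" and X: "X \<subseteq> Y \<union> Z" "X \<inter> Y \<inter> Z = {}"
  shows "card (edge_cut G (Y \<union> Z)) + card (edge_cut G (Y \<inter> Z)) +
      card (edge_cut G (X \<inter> Y)) + card (edge_cut G (X \<inter> Z))
    \<le> card (edge_cut G X) + card (edge_cut G Y) + card (edge_cut G Z)" (is "?l \<le> ?r")
proof -
  have "int ?l \<le> int ?r"
    unfolding of_nat_add of_nat_mult count_sums[OF G] sum_distrib_left sum.distrib[symmetric]
  proof (rule sum_mono)
    fix e assume "e \<in> edges G"
    then obtain a b where "ends G e = {a, b}" by (rule ends_obtain[OF G])
    moreover have "a \<in> X \<Longrightarrow> a \<in> Y \<longleftrightarrow> a \<notin> Z" "b \<in> X \<Longrightarrow> b \<in> Y \<longleftrightarrow> b \<notin> Z" using X by auto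
    ultimately show "of_bool (ends G e \<inter> (Y \<union> Z) \<noteq> {} \<and> \<not> ends G e \<subseteq> Y \<union> Z) +
       of_bool (ends G e \<inter> (Y \<inter> Z) \<noteq> {} \<and> \<not> ends G e \<subseteq> Y \<inter> Z) +
       of_bool (ends G e \<inter> (X \<inter> Y) \<noteq> {} \<and> \<not> ends G e \<subseteq> X \<inter> Y) +
       of_bool (ends G e \<inter> (X \<inter> Z) \<noteq> {} \<and> \<not> ends G e \<subseteq> X \<inter> Z)
       \<le> (of_bool (ends G e \<inter> X \<noteq> {} \<and> \<not> ends G e \<subseteq> X) +
       of_bool (ends G e \<inter> Y \<noteq> {} \<and> \<not> ends G e \<subseteq> Y) +
       of_bool (ends G e \<inter> Z \<noteq> {} \<and> \<not> ends G e \<subseteq> Z) :: int)"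
      by (cases "a \<in> X"; cases "a \<in> Y"; cases "a \<in> Z"; cases "b \<in> X"; cases "b \<in> Y"; cases "b \<in> Z")
        simp_all
  qed
  then show ?thesis by linarith
qed

section \<open>Lifting and cuts\<close>

text \<open>Menger's theorem for all pairs at once. A separating set that contains \<open>s\<close>
  is replaced by its complement, which has the same cut.\<close>

lemma sk_edge_connected_iff_cuts:
  "sk_edge_connected G s k \<longleftrightarrow>
     finite_loopless_multigraph G \<and> card (verts G) \<ge> 3 \<and> s \<in> verts G \<and> k > 0 \<and>
     (\<forall>X. X \<noteq> {} \<and> X \<subset> verts G - {s} \<longrightarrow> k \<le> card (edge_cut G X))" (is "?l \<longleftrightarrow> ?r")
proof
  assume l: ?l
  then have G: "finite_loopless_multigraph G" by (simp add: sk_edge_connected_def)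
  have "k \<le> card (edge_cut G X)" if X: "X \<noteq> {}" "X \<subset> verts G - {s}" for X
  proof -
    obtain u v where "u \<in> X" "u \<in> verts G - {s}" "v \<in> verts G - {s}" "v \<notin> X" using X by blast
    moreover from this have "joined_by_edge_disjoint_paths G k u v"
      using l by (metis sk_edge_connected_def)
    ultimately show ?thesis using edge_disjoint_paths_cut[OF G] by blast
  qed
  with l show ?r by (simp add: sk_edge_connected_def)
next
  assume r: ?r
  then have G: "finite_loopless_multigraph G"
    and cuts: "\<And>X. X \<noteq> {} \<Longrightarrow> X \<subset> verts G - {s} \<Longrightarrow> k \<le> card (edge_cut G X)"
    by simp_all
  have "joined_by_edge_disjoint_paths G k u v"
    if uv: "u \<in> verts G - {s}" "v \<in> verts G - {s}" "u \<noteq> v" for u v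
  proof (rule menger[OF G])
    fix X assume X: "X \<subseteq> verts G" "u \<in> X" "v \<notin> X"
    show "k \<le> card (edge_cut G X)"
    proof (cases "s \<in> X")
      case True
      with X uv have "verts G - X \<noteq> {}" "verts G - X \<subset> verts G - {s}" by auto
      then have "k \<le> card (edge_cut G (verts G - X))" by (rule cuts)
      then show ?thesis by (simp only: edge_cut_complement[OF G])
    next
      case False
      with X uv have "X \<noteq> {}" "X \<subset> verts G - {s}" by auto
      then show ?thesis by (rule cuts)
    qed
  qed (use uv in auto)
  with r show ?l by (auto simp: sk_edge_connected_def)
qed

lemma other_end:
  assumes "finite_loopless_multigraph G" "e \<in> incident_edges G s"
  shows "ends G e = {s, other_end G s e}" "other_end G s e \<noteq> s"
    "other_end G s e \<in> verts G" "e \<in> edges G"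
proof -
  show e: "e \<in> edges G" using assms by (simp add: incident_edges_def)
  then obtain x y where xy: "ends G e = {x, y}" "x \<noteq> y" "x \<in> verts G" "y \<in> verts G"
    by (rule ends_obtain[OF assms(1)])
  have "s = x \<or> s = y" using xy assms(2) by (simp add: incident_edges_def)
  then obtain z where z: "ends G e = {s, z}" "z \<noteq> s" "z \<in> verts G" using xy by blast
  then have "ends G e - {s} = {z}" by auto
  then have "other_end G s e = z" by (simp add: other_end_def)
  with z show "ends G e = {s, other_end G s e}" "other_end G s e \<noteq> s"
    "other_end G s e \<in> verts G"
    by simp_all
qed

lemma edges_into_iff:
  assumes "finite_loopless_multigraph G" "s \<notin> X"
  shows "e \<in> edges_into G s X \<longleftrightarrow> e \<in> incident_edges G s \<and> other_end G s e \<in> X"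
  using other_end(1)[OF assms(1), of e s] assms(2)
  by (cases "e \<in> incident_edges G s") (simp_all add: edges_into_def)

context
  fixes G :: "('v, 'e) multigraph" and s :: 'v and e f :: 'e
  assumes G: "finite_loopless_multigraph G"
    and ef: "e \<in> incident_edges G s" "f \<in> incident_edges G s" "e \<noteq> f"
begin

lemma verts_lift_pair: "verts (lift_pair G s e f) = verts G"
  by (simp add: lift_pair_def Let_def)

lemma finite_loopless_lift_pair: "finite_loopless_multigraph (lift_pair G s e f)"
  using G other_end(3,4)[OF G ef(1)] other_end(3)[OF G ef(2)]
  by (simp add: lift_pair_def Let_def finite_loopless_multigraph_def)

text \<open>If both edges lead from \<open>s\<close> into \<open>X\<close>, they leave the cut and
  the new edge, if any, lies inside \<open>X\<close>. In every other case the new edge replaces what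
  is lost.\<close>

lemma card_edge_cut_lift_pair:
  assumes s: "s \<notin> X"
  shows "card (edge_cut (lift_pair G s e f) X) + (if {e, f} \<subseteq> edges_into G s X then 2 else 0) =
    card (edge_cut G X)"
proof -
  define R where "R = edges G - {e, f}"
  define v where "v = other_end G s e"
  define w where "w = other_end G s f"
  have e: "ends G e = {s, v}" "v \<noteq> s" and f: "ends G f = {s, w}" "w \<noteq> s"
    using other_end[OF G ef(1)] other_end[OF G ef(2)] by (auto simp: v_def w_def)
  have E: "edges G = insert e (insert f R)"
    using other_end(4)[OF G] ef by (auto simp: R_def)
  have R: "finite R" "e \<notin> R" "f \<notin> R" "e \<notin> insert f R"
    using G ef(3) by (auto simp: R_def finite_loopless_multigraph_def)
  define c where "c g = (of_bool (ends G g \<inter> X \<noteq> {} \<and> \<not> ends G g \<subseteq> X) :: int)" for g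
  have "int (card (edge_cut G X)) = c e + c f + sum c R"
    unfolding card_edge_cut[OF G] E c_def[symmetric] using R by simp
  also have "c e = of_bool (v \<in> X)" using e s by (auto simp: c_def)
  also have "c f = of_bool (w \<in> X)" using f s by (auto simp: c_def)
  finally have cG: "int (card (edge_cut G X)) = of_bool (v \<in> X) + of_bool (w \<in> X) + sum c R" .
  have sub: "{e, f} \<subseteq> edges_into G s X \<longleftrightarrow> v \<in> X \<and> w \<in> X"
    using edges_into_iff[OF G s] ef by (auto simp: v_def w_def)
  note H = card_edge_cut[OF finite_loopless_lift_pair, of X]
  show ?thesis
  proof (cases "v = w")
    case True
    then have "int (card (edge_cut (lift_pair G s e f) X)) = sum c R"
      unfolding H by (simp add: lift_pair_def Let_def v_def w_def c_def R_def)
    then show ?thesis using cG True sub by (auto split: if_splits)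
  next
    case False
    have *: "edges (lift_pair G s e f) = insert e R" "ends (lift_pair G s e f) = (ends G)(e := {v, w})"
      using False by (simp_all add: lift_pair_def Let_def v_def w_def R_def)
    have "int (card (edge_cut (lift_pair G s e f) X)) = of_bool (v \<in> X \<longleftrightarrow> w \<notin> X) +
        (\<Sum>g\<in>R. of_bool (((ends G)(e := {v, w})) g \<inter> X \<noteq> {} \<and> \<not> ((ends G)(e := {v, w})) g \<subseteq> X))"
      unfolding H * using R by auto
    also have "(\<Sum>g\<in>R. of_bool (((ends G)(e := {v, w})) g \<inter> X \<noteq> {} \<and> \<not> ((ends G)(e := {v, w})) g \<subseteq> X))
        = sum c R"
      using R by (intro sum.cong refl) (auto simp: c_def)
    finally show ?thesis using cG sub by (cases "v \<in> X"; cases "w \<in> X") auto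
  qed
qed

end

section \<open>Dangerous sets\<close>

locale sk_connected_graph =
  fixes G :: "('v, 'e) multigraph" and s :: 'v and k :: nat
  assumes sk: "sk_edge_connected G s k" and k2: "k \<ge> 2" and deg4: "degree G s \<ge> 4"
begin

abbreviation "U \<equiv> verts G - {s}"
abbreviation "D \<equiv> degree G s"
abbreviation "d X \<equiv> card (edge_cut G X)"
abbreviation "\<sigma> X \<equiv> edges_into G s X"
abbreviation "L \<equiv> lifting_graph G s k"

text \<open>Lifting two edges that enter \<open>X\<close> from \<open>s\<close> lowers the cut by
  exactly 2, hence below \<open>k\<close> precisely when it was at most
  \<open>k + 1\<close>.\<close>

definition dangerous :: "'v set \<Rightarrow> bool" where
  "dangerous X \<longleftrightarrow> X \<noteq> {} \<and> X \<subset> U \<and> d X \<le> k + 1"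

lemma G: "finite_loopless_multigraph G"
  using sk by (simp add: sk_edge_connected_def)

lemma cut_ge: "X \<noteq> {} \<Longrightarrow> X \<subset> U \<Longrightarrow> k \<le> d X"
  using sk by (simp add: sk_edge_connected_iff_cuts)

lemma dangerousD:
  assumes "dangerous X"
  shows "X \<noteq> {}" "X \<subset> U" "X \<subseteq> U" "d X \<le> k + 1" "s \<notin> X"
  using assms by (auto simp: dangerous_def)

lemma finite_incident: "finite (incident_edges G s)"
  using G by (simp add: incident_edges_def finite_loopless_multigraph_def)

lemma edges_into_incident: "\<sigma> X \<subseteq> incident_edges G s"
  by (auto simp: edges_into_def)

lemma finite_edges_into: "finite (\<sigma> X)"
  using finite_incident edges_into_incident finite_subset by metis

lemma edges_into_U: "\<sigma> U = incident_edges G s"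
proof -
  have "e \<in> \<sigma> U" if "e \<in> incident_edges G s" for e
    using other_end(2,3)[OF G that] that edges_into_iff[OF G, of s U e] by simp
  then show ?thesis using edges_into_incident by blast
qed

lemma edges_into_Un: "\<sigma> (X \<union> Y) = \<sigma> X \<union> \<sigma> Y"
  by (auto simp: edges_into_def)

lemma edges_into_set_ops:
  assumes "X \<subseteq> U" "Y \<subseteq> U"
  shows "\<sigma> (X \<inter> Y) = \<sigma> X \<inter> \<sigma> Y" "\<sigma> (X - Y) = \<sigma> X - \<sigma> Y"
proof -
  have *: "s \<notin> X" "s \<notin> Y" "s \<notin> X \<inter> Y" "s \<notin> X - Y" using assms by auto
  show "\<sigma> (X \<inter> Y) = \<sigma> X \<inter> \<sigma> Y" "\<sigma> (X - Y) = \<sigma> X - \<sigma> Y"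
    using edges_into_iff[OF G *(1)] edges_into_iff[OF G *(2)] edges_into_iff[OF G *(3)]
      edges_into_iff[OF G *(4)] by blast+
qed

lemma edges_into_mono: "X \<subseteq> Y \<Longrightarrow> \<sigma> X \<subseteq> \<sigma> Y"
  by (auto simp: edges_into_def)

text \<open>The connectivity bound is applied to \<open>U - X\<close> instead of
  \<open>X\<close>.\<close>

lemma edges_into_bound:
  assumes "X \<noteq> {}" "X \<subset> U"
  shows "2 * card (\<sigma> X) + k \<le> d X + D"
proof -
  have "k \<le> d (U - X)" using assms by (intro cut_ge) auto
  then show ?thesis using cut_complement_avoiding[OF G, of X s] assms by auto
qed

lemma dangerous_edges_bound: "dangerous X \<Longrightarrow> 2 * card (\<sigma> X) \<le> D + 1"
  using edges_into_bound[of X] by (auto simp: dangerous_def)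

lemma liftable_iff:
  assumes ef: "e \<in> incident_edges G s" "f \<in> incident_edges G s" "e \<noteq> f"
  shows "liftable_pair G s k e f \<longleftrightarrow> (\<nexists>X. dangerous X \<and> e \<in> \<sigma> X \<and> f \<in> \<sigma> X)"
proof -
  let ?H = "lift_pair G s e f"
  have "liftable_pair G s k e f \<longleftrightarrow>
      (\<forall>X. X \<noteq> {} \<and> X \<subset> U \<longrightarrow> k \<le> card (edge_cut ?H X))"
    using sk ef finite_loopless_lift_pair[OF G ef] verts_lift_pair[OF G ef]
    by (simp add: liftable_pair_def sk_edge_connected_iff_cuts)
  also have "\<dots> \<longleftrightarrow> (\<forall>X. X \<noteq> {} \<and> X \<subset> U \<longrightarrow> \<not> (dangerous X \<and> e \<in> \<sigma> X \<and> f \<in> \<sigma> X))"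
  proof (intro all_cong1 imp_cong refl)
    fix X assume X: "X \<noteq> {} \<and> X \<subset> U"
    then have "s \<notin> X" by auto
    from card_edge_cut_lift_pair[OF G ef this] cut_ge[of X] X
    show "k \<le> card (edge_cut ?H X) \<longleftrightarrow> \<not> (dangerous X \<and> e \<in> \<sigma> X \<and> f \<in> \<sigma> X)"
      by (auto simp: dangerous_def split: if_splits)
  qed
  also have "\<dots> \<longleftrightarrow> (\<nexists>X. dangerous X \<and> e \<in> \<sigma> X \<and> f \<in> \<sigma> X)"
    by (auto simp: dangerous_def)
  finally show ?thesis .
qed

lemma adjacent_iff:
  assumes "e \<in> incident_edges G s" "f \<in> incident_edges G s"
  shows "{e, f} \<in> snd L \<longleftrightarrow> e \<noteq> f \<and> (\<nexists>X. dangerous X \<and> e \<in> \<sigma> X \<and> f \<in> \<sigma> X)"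
proof -
  have "{e, f} \<in> snd L \<longleftrightarrow> liftable_pair G s k e f \<or> liftable_pair G s k f e"
    by (auto simp: lifting_graph_def doubleton_eq_iff)
  also have "\<dots> \<longleftrightarrow> e \<noteq> f \<and> (\<nexists>X. dangerous X \<and> e \<in> \<sigma> X \<and> f \<in> \<sigma> X)"
  proof (cases "e = f")
    case True
    then show ?thesis by (simp add: liftable_pair_def)
  next
    case False
    then show ?thesis
      using liftable_iff[OF assms] liftable_iff[OF assms(2,1)] by blast
  qed
  finally show ?thesis .
qed

lemma fst_L: "fst L = incident_edges G s"
  by (simp add: lifting_graph_def)

lemma snd_L_subset: "p \<in> snd L \<Longrightarrow> \<exists>e f. p = {e, f} \<and> e \<in> fst L \<and> f \<in> fst L \<and> e \<noteq> f"
  unfolding lifting_graph_def liftable_pair_def fst_conv snd_conv by blast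

lemma independent_iff:
  "independent_set L I \<longleftrightarrow> I \<subseteq> incident_edges G s \<and>
     (\<forall>e\<in>I. \<forall>f\<in>I. e \<noteq> f \<longrightarrow> (\<exists>X. dangerous X \<and> e \<in> \<sigma> X \<and> f \<in> \<sigma> X))"
proof (cases "I \<subseteq> incident_edges G s")
  case True
  then have "{e, f} \<notin> snd L \<longleftrightarrow> e \<noteq> f \<longrightarrow> (\<exists>X. dangerous X \<and> e \<in> \<sigma> X \<and> f \<in> \<sigma> X)"
    if "e \<in> I" "f \<in> I" for e f
    using adjacent_iff[of e f] that by blast
  then show ?thesis using True unfolding independent_set_def fst_L by simp
qed (simp add: independent_set_def fst_L)

lemma independent_edges_into: "dangerous X \<Longrightarrow> independent_set L (\<sigma> X)"
  unfolding independent_iff using edges_into_incident by blast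

text \<open>The differences have cuts of at least \<open>k\<close> each and a shared edge adds at
  least 2, while the right-hand side of \<open>cut_posimodular\<close> is at most
  \<open>2 * k + 2\<close>; so every estimate is an equality.\<close>

lemma crossing:
  assumes X: "dangerous X" and Y: "dangerous Y" and z: "\<sigma> X \<inter> \<sigma> Y \<noteq> {}"
    and XY: "X - Y \<noteq> {}" "Y - X \<noteq> {}"
  shows "card (\<sigma> X \<inter> \<sigma> Y) = 1" "d X = k + 1" "d Y = k + 1" "d (X - Y) = k" "d (Y - X) = k"
proof -
  have XU: "X \<subset> U" "Y \<subset> U" "X \<subseteq> U" "Y \<subseteq> U" using dangerousD X Y by auto
  have "card (\<sigma> X \<inter> \<sigma> Y) > 0" using z finite_edges_into by (simp add: card_gt_0_iff)
  moreover have "d (X - Y) + d (Y - X) + 2 * card (\<sigma> X \<inter> \<sigma> Y) \<le> d X + d Y"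
    using cut_posimodular[OF G, of s X Y] dangerousD(5)[OF X] dangerousD(5)[OF Y]
      edges_into_set_ops(1)[OF XU(3,4)] by simp
  moreover have "k \<le> d (X - Y)" "k \<le> d (Y - X)" using XY XU by (auto intro!: cut_ge)
  moreover note dangerousD(4)[OF X] dangerousD(4)[OF Y]
  ultimately show "card (\<sigma> X \<inter> \<sigma> Y) = 1" "d X = k + 1" "d Y = k + 1" "d (X - Y) = k" "d (Y - X) = k"
    by linarith+
qed

text \<open>The complements in \<open>U\<close> are the two differences, so all cut sizes in
  \<open>cut_complement_avoiding\<close> are known exactly.\<close>

lemma crossing_cover:
  assumes X: "dangerous X" and Y: "dangerous Y" and z: "\<sigma> X \<inter> \<sigma> Y \<noteq> {}"
    and XY: "X - Y \<noteq> {}" "Y - X \<noteq> {}" and cover: "X \<union> Y = U"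
  shows "odd D" "2 * card (\<sigma> X) = D + 1" "2 * card (\<sigma> Y) = D + 1"
proof -
  note c = crossing[OF X Y z XY]
  have XU: "X \<subseteq> U" "Y \<subseteq> U" using dangerousD X Y by auto
  have "U - X = Y - X" "U - Y = X - Y" using cover by auto
  then have "k + 2 * card (\<sigma> X) = k + 1 + D" "k + 2 * card (\<sigma> Y) = k + 1 + D"
    using cut_complement_avoiding[OF G XU(1)] cut_complement_avoiding[OF G XU(2)] c by simp_all
  then show "2 * card (\<sigma> X) = D + 1" "2 * card (\<sigma> Y) = D + 1" by simp_all
  then show "odd D" by presburger
qed

text \<open>The last claim is a parity argument: \<open>X\<close> is the disjoint union of
  \<open>X - Y\<close> and \<open>X \<inter> Y\<close>, with cuts \<open>k + 1\<close> for
  \<open>X\<close> and \<open>k\<close> for \<open>X - Y\<close>, so the cut of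
  \<open>X \<inter> Y\<close> is odd. For even \<open>k\<close> it is at least \<open>k + 1\<close>,
  and submodularity leaves at most \<open>k + 1\<close> for the union.\<close>

lemma crossing_union:
  assumes X: "dangerous X" and Y: "dangerous Y" and z: "\<sigma> X \<inter> \<sigma> Y \<noteq> {}"
    and XY: "X - Y \<noteq> {}" "Y - X \<noteq> {}" and cover: "X \<union> Y \<noteq> U"
  shows "X \<union> Y \<subset> U" "d (X \<inter> Y) + d (X \<union> Y) \<le> 2 * k + 2" "k \<le> d (X \<inter> Y)"
    "even k \<Longrightarrow> dangerous (X \<union> Y)"
proof -
  note c = crossing[OF X Y z XY]
  have XU: "X \<subset> U" "Y \<subset> U" "X \<subseteq> U" "Y \<subseteq> U" using dangerousD X Y by auto
  show un: "X \<union> Y \<subset> U" using cover XU by auto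
  show *: "d (X \<inter> Y) + d (X \<union> Y) \<le> 2 * k + 2" using cut_submodular[OF G, of X Y] c by simp
  have "X \<inter> Y \<noteq> {}" using z edges_into_set_ops(1)[OF XU(3,4)] by (auto simp: edges_into_def)
  then show ge: "k \<le> d (X \<inter> Y)" using XU by (intro cut_ge) auto
  have "even (d (X - Y) + d (X \<inter> Y) + d ((X - Y) \<union> (X \<inter> Y)))"
    by (rule cut_disjoint_union_parity[OF G]) auto
  moreover have "(X - Y) \<union> (X \<inter> Y) = X" by auto
  ultimately have "odd (d (X \<inter> Y))" using c by (cases "even k") simp_all
  then show "dangerous (X \<union> Y)" if "even k"
  proof -
    have "d (X \<inter> Y) \<noteq> k" using that \<open>odd (d (X \<inter> Y))\<close> by auto
    then show ?thesis using * ge un dangerousD(1)[OF X] by (auto simp: dangerous_def)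
  qed
qed

lemma no_triangle:
  assumes X: "dangerous X" and Y: "dangerous Y" and Z: "dangerous Z"
    and e: "e \<in> \<sigma> X \<inter> \<sigma> Y - \<sigma> Z" and f: "f \<in> \<sigma> X \<inter> \<sigma> Z - \<sigma> Y" and g: "g \<in> \<sigma> Y \<inter> \<sigma> Z - \<sigma> X"
    and un: "k + 2 \<le> d (X \<union> Y)" "k + 2 \<le> d (X \<union> Z)" "k + 2 \<le> d (Y \<union> Z)"
  shows False
proof -
  note D = dangerousD[OF X] dangerousD[OF Y] dangerousD[OF Z]
  have sub: "X \<subseteq> U" "Y \<subseteq> U" "Z \<subseteq> U" "X \<inter> Y \<subseteq> U" "X \<inter> Z \<subseteq> U" "Y \<inter> Z \<subseteq> U" using D by auto
  have \<sigma>: "\<sigma> (X \<inter> Y - Z) = \<sigma> X \<inter> \<sigma> Y - \<sigma> Z" "\<sigma> (X \<inter> Z - Y) = \<sigma> X \<inter> \<sigma> Z - \<sigma> Y"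
    "\<sigma> (Y \<inter> Z - X) = \<sigma> Y \<inter> \<sigma> Z - \<sigma> X"
    using edges_into_set_ops sub by metis+
  have pos: "0 < card (\<sigma> (X \<inter> Y - Z))" "0 < card (\<sigma> (X \<inter> Z - Y))" "0 < card (\<sigma> (Y \<inter> Z - X))"
    unfolding card_gt_0_iff using e f g finite_edges_into \<sigma> by auto
  have ne: "X \<inter> Y - Z \<noteq> {}" "X \<inter> Z - Y \<noteq> {}" "Y \<inter> Z - X \<noteq> {}"
    using e f g unfolding \<sigma>[symmetric] by (auto simp: edges_into_def)
  have ge: "k \<le> d A" if "A \<noteq> {}" "A \<subseteq> X \<or> A \<subseteq> Y \<or> A \<subseteq> Z" for A
    using that D by (intro cut_ge) auto
  have ge': "k \<le> d (X \<inter> Y)" "k \<le> d (X \<inter> Z)" "k \<le> d (Y \<inter> Z)"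
    "k \<le> d (X \<inter> Y - Z)" "k \<le> d (X \<inter> Z - Y)" "k \<le> d (Y \<inter> Z - X)"
    using ne by (auto intro!: ge)
  \<comment> \<open>Submodularity: two cuts of at most \<open>k + 1\<close> and a union of at least
    \<open>k + 2\<close> leave at most \<open>k\<close> for the intersection.\<close>
  have inter: "d (X \<inter> Y) \<le> k" "d (X \<inter> Z) \<le> k" "d (Y \<inter> Z) \<le> k"
    using cut_submodular[OF G, of X Y] cut_submodular[OF G, of X Z] cut_submodular[OF G, of Y Z]
      un D by linarith+
  \<comment> \<open>Otherwise four cuts of size at least \<open>k\<close> would be bounded by three
    of size \<open>k\<close>.\<close>
  have T: "X \<inter> Y \<inter> Z = {}"
  proof (rule ccontr)
    assume "X \<inter> Y \<inter> Z \<noteq> {}"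
    then have "k \<le> d (X \<inter> Y \<inter> Z)" by (rule ge) auto
    then show False using cut_three_pairwise_intersections[OF G, of X Y Z] ge' inter k2 by linarith
  qed
  \<comment> \<open>Otherwise \<open>cut_three_covered\<close> would give
    \<open>(k + 2) + 3 * k\<close> as a lower bound for a sum that is at most
    \<open>3 * k + 3\<close>, impossible for \<open>k\<close> at least 2.\<close>
  have "X - Y - Z \<noteq> {}"
  proof
    assume "X - Y - Z = {}"
    then have "X \<subseteq> Y \<union> Z" by blast
    from cut_three_covered[OF G this T] D un ge' k2 show False by linarith
  qed
  moreover have "Y - X - Z \<noteq> {}"
  proof
    assume "Y - X - Z = {}"
    then have "Y \<subseteq> X \<union> Z" "Y \<inter> X \<inter> Z = {}" using T by blast+
    from cut_three_covered[OF G this, unfolded Int_commute[of Y X]] D un ge' k2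
    show False by linarith
  qed
  moreover have "Z - X - Y \<noteq> {}"
  proof
    assume "Z - X - Y = {}"
    then have "Z \<subseteq> X \<union> Y" "Z \<inter> X \<inter> Y = {}" using T by blast+
    from cut_three_covered[OF G this, unfolded Int_commute[of Z]] D un ge' k2
    show False by linarith
  qed
  ultimately have "k \<le> d (X - Y - Z)" "k \<le> d (Y - X - Z)" "k \<le> d (Z - X - Y)"
    by (auto intro!: ge)
  \<comment> \<open>The left-hand side of \<open>cut_three_differences\<close> is now at least
    \<open>3 * k + 6\<close>, the right-hand side at most \<open>3 * k + 3\<close>.\<close>
  then show False
    using cut_three_differences[OF G, of s X Y Z] D pos by linarith
qed

text \<open>If \<open>g\<close> were outside \<open>\<sigma> X\<close>, maximality of
  \<open>X\<close> would leave no dangerous set containing all three edges. Then \<open>X\<close>,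
  \<open>Y\<close>, \<open>Z\<close> form the configuration excluded by \<open>no_triangle\<close>,
  once no two of them cover \<open>U\<close>.\<close>

lemma maximal_dangerous_absorbs:
  assumes X: "dangerous X" and e: "e \<in> \<sigma> X" and f: "f \<in> \<sigma> X" and ef: "e \<noteq> f"
    and max: "\<And>W. dangerous W \<Longrightarrow> e \<in> \<sigma> W \<Longrightarrow> f \<in> \<sigma> W \<Longrightarrow> card (\<sigma> W) \<le> card (\<sigma> X)"
    and Y: "dangerous Y" "e \<in> \<sigma> Y" "g \<in> \<sigma> Y" and Z: "dangerous Z" "f \<in> \<sigma> Z" "g \<in> \<sigma> Z"
  shows "g \<in> \<sigma> X"
proof (rule ccontr)
  assume g: "g \<notin> \<sigma> X"
  have no_larger: False if "dangerous W" "e \<in> \<sigma> W" "f \<in> \<sigma> W" "g \<in> \<sigma> W" "\<sigma> X \<subseteq> \<sigma> W" for W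
  proof -
    have "\<sigma> X \<subset> \<sigma> W" using that g by auto
    then have "card (\<sigma> X) < card (\<sigma> W)" by (intro psubset_card_mono finite_edges_into)
    then show False using max[OF that(1-3)] by simp
  qed
  \<comment> \<open>Either \<open>W\<close> contains \<open>X\<close> and contradicts maximality, or
    \<open>X\<close> and \<open>W\<close> cross while sharing the two edges \<open>e\<close> and
    \<open>f\<close>.\<close>
  have not_both: False if W: "dangerous W" "e \<in> \<sigma> W" "f \<in> \<sigma> W" "g \<in> \<sigma> W" for W
  proof (cases "X - W = {}")
    case True
    then have "\<sigma> X \<subseteq> \<sigma> W" by (intro edges_into_mono) auto
    then show False using no_larger W by blast
  next
    case False
    have "W - X \<noteq> {}" using edges_into_mono[of W X] W g by blast
    then have "card (\<sigma> X \<inter> \<sigma> W) = 1" using crossing(1)[OF X W(1) _ False] e W by blast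
    then obtain z where "\<sigma> X \<inter> \<sigma> W = {z}" by (auto simp: card_1_singleton_iff)
    moreover have "e \<in> \<sigma> X \<inter> \<sigma> W" "f \<in> \<sigma> X \<inter> \<sigma> W" using e f W by simp_all
    ultimately show False using ef by simp
  qed
  have fY: "f \<notin> \<sigma> Y" and eZ: "e \<notin> \<sigma> Z" using not_both Y Z by blast+
  have diff: "A - B \<noteq> {}" if "a \<in> \<sigma> A" "a \<notin> \<sigma> B" for a A B
    using that edges_into_mono[of A B] by blast
  note ne = diff[OF f fY] diff[OF Y(3) g] diff[OF e eZ] diff[OF Z(3) g] diff[OF Y(2) eZ] diff[OF Z(2) fY]
  have i: "\<sigma> X \<inter> \<sigma> Y \<noteq> {}" "\<sigma> X \<inter> \<sigma> Z \<noteq> {}" "\<sigma> Y \<inter> \<sigma> Z \<noteq> {}" using e f Y Z by auto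
  then have i': "\<sigma> Y \<inter> \<sigma> X \<noteq> {}" "\<sigma> Z \<inter> \<sigma> X \<noteq> {}" "\<sigma> Z \<inter> \<sigma> Y \<noteq> {}" by (simp_all add: Int_commute)
  \<comment> \<open>If \<open>A\<close> and \<open>B\<close> cover \<open>U\<close>, then only two edges join \<open>s\<close> to \<open>C\<close>, so \<open>A \<union> C \<noteq> U\<close>; but since
    \<open>A\<close> alone receives \<open>(D + 1) / 2\<close> edges from \<open>s\<close>, \<open>A \<union> C\<close> receives more than its cut allows.\<close>
  have covering: False
    if A: "dangerous A" "dangerous B" "dangerous C" and i: "\<sigma> A \<inter> \<sigma> B \<noteq> {}" "\<sigma> A \<inter> \<sigma> C \<noteq> {}"
      "\<sigma> B \<inter> \<sigma> C \<noteq> {}" and ne: "A - B \<noteq> {}" "B - A \<noteq> {}" "A - C \<noteq> {}" "C - A \<noteq> {}" "B - C \<noteq> {}" "C - B \<noteq> {}"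
      and c: "c \<in> \<sigma> C" "c \<notin> \<sigma> A" and cover: "A \<union> B = U" for A B C c
  proof -
    have odd: "odd D" and A2: "2 * card (\<sigma> A) = D + 1"
      using crossing_cover[OF A(1,2) i(1) ne(1,2) cover] by blast+
    have "\<sigma> C \<subseteq> \<sigma> (A \<union> B)"
      unfolding cover edges_into_U by (rule edges_into_incident)
    then have "\<sigma> C \<subseteq> (\<sigma> A \<inter> \<sigma> C) \<union> (\<sigma> B \<inter> \<sigma> C)"
      unfolding edges_into_Un by blast
    then have "card (\<sigma> C) \<le> card ((\<sigma> A \<inter> \<sigma> C) \<union> (\<sigma> B \<inter> \<sigma> C))"
      by (intro card_mono) (simp_all add: finite_edges_into)
    also have "\<dots> \<le> card (\<sigma> A \<inter> \<sigma> C) + card (\<sigma> B \<inter> \<sigma> C)" by (rule card_Un_le)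
    finally have C2: "card (\<sigma> C) \<le> 2"
      using crossing(1)[OF A(1,3) i(2) ne(3,4)] crossing(1)[OF A(2,3) i(3) ne(5,6)] by simp
    have "D \<noteq> 4" using odd by auto
    then have D5: "D \<ge> 5" using deg4 by simp
    have AC: "A \<union> C \<noteq> U"
      using crossing_cover(3)[OF A(1,3) i(2) ne(3,4)] C2 D5 by auto
    note u = crossing_union[OF A(1,3) i(2) ne(3,4) AC]
    have "d (A \<union> C) \<le> k + 2" using u by linarith
    moreover have "2 * card (\<sigma> (A \<union> C)) + k \<le> d (A \<union> C) + D"
      using u(1) ne by (intro edges_into_bound) auto
    moreover have "card (\<sigma> A) < card (\<sigma> (A \<union> C))"
      unfolding edges_into_Un using c by (intro psubset_card_mono) (auto simp: finite_edges_into)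
    \<comment> \<open>With at least \<open>(D + 1) / 2 + 1\<close> edges into
      \<open>A \<union> C\<close>, the bound would read
      \<open>D + 3 + k \<le> k + 2 + D\<close>.\<close>
    ultimately show False using A2 by linarith
  qed
  have XYU: "X \<union> Y \<noteq> U" using covering[OF X Y(1) Z(1) i ne Z(3) g] by blast
  have XZU: "X \<union> Z \<noteq> U" using covering[OF X Z(1) Y(1) i(2,1) i'(3) ne(3,4,1,2,6,5) Y(3) g] by blast
  have YZU: "Y \<union> Z \<noteq> U" using covering[OF Y(1) Z(1) X i(3) i'(1,2) ne(5,6,2,1,4,3) f fY] by blast
  \<comment> \<open>The union of any two of the sets contains all three edges, so by
    \<open>not_both\<close> it is not dangerous.\<close>
  have big: "k + 2 \<le> d (A \<union> B)"
    if "A \<union> B \<subset> U" "A \<noteq> {}" "e \<in> \<sigma> (A \<union> B)" "f \<in> \<sigma> (A \<union> B)" "g \<in> \<sigma> (A \<union> B)" for A B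
  proof (rule ccontr)
    assume "\<not> k + 2 \<le> d (A \<union> B)"
    then have "dangerous (A \<union> B)" using that(1,2) by (simp add: dangerous_def)
    then show False using not_both that(3-) by blast
  qed
  have "k + 2 \<le> d (X \<union> Y)"
    using crossing_union(1)[OF X Y(1) i(1) ne(1,2) XYU] dangerousD(1)[OF X] e f Y
    by (intro big) (auto simp: edges_into_Un)
  moreover have "k + 2 \<le> d (X \<union> Z)"
    using crossing_union(1)[OF X Z(1) i(2) ne(3,4) XZU] dangerousD(1)[OF X] e f Z
    by (intro big) (auto simp: edges_into_Un)
  moreover have "k + 2 \<le> d (Y \<union> Z)"
    using crossing_union(1)[OF Y(1) Z(1) i(3) ne(5,6) YZU] dangerousD(1)[OF Y(1)] Y Z
    by (intro big) (auto simp: edges_into_Un)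
  ultimately show False
    using no_triangle[OF X Y(1) Z(1), of e f g] e f g Y Z fY eZ by blast
qed

section \<open>Maximal independent sets\<close>

text \<open>A dangerous set with the most edges from \<open>s\<close> among those containing
  \<open>e\<close> and \<open>f\<close> serves all independent sets through this pair at
  once.\<close>

lemma independent_pair_absorbed:
  assumes ef: "independent_set L {e, f}" "e \<noteq> f"
  obtains X where "dangerous X" "\<And>I. independent_set L I \<Longrightarrow> e \<in> I \<Longrightarrow> f \<in> I \<Longrightarrow> I \<subseteq> \<sigma> X"
proof -
  let ?P = "\<lambda>X. dangerous X \<and> e \<in> \<sigma> X \<and> f \<in> \<sigma> X"
  obtain X0 where "?P X0" using ef unfolding independent_iff by blast
  moreover have "\<forall>X. ?P X \<longrightarrow> card (\<sigma> X) < Suc D"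
    unfolding degree_def less_Suc_eq_le using card_mono[OF finite_incident edges_into_incident] by simp
  ultimately obtain X where X: "?P X" and max: "\<And>W. ?P W \<Longrightarrow> card (\<sigma> W) \<le> card (\<sigma> X)"
    using ex_has_greatest_nat[of ?P X0 "\<lambda>X. card (\<sigma> X)" "Suc D"] by blast
  have "I \<subseteq> \<sigma> X" if I: "independent_set L I" "e \<in> I" "f \<in> I" for I
  proof
    fix g assume g: "g \<in> I"
    show "g \<in> \<sigma> X"
    proof (cases "g = e \<or> g = f")
      case False
      obtain Y Z where "dangerous Y" "e \<in> \<sigma> Y" "g \<in> \<sigma> Y" "dangerous Z" "f \<in> \<sigma> Z" "g \<in> \<sigma> Z"
        using I g False unfolding independent_iff by metis
      then show ?thesis using maximal_dangerous_absorbs[of X e f Y g Z] X max ef(2) by blast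
    qed (use X in auto)
  qed
  with X that show ?thesis by blast
qed

lemma independent_subset: "independent_set L I \<Longrightarrow> J \<subseteq> I \<Longrightarrow> independent_set L J"
  unfolding independent_iff by blast

lemma independent_finite: "independent_set L I \<Longrightarrow> finite I"
  unfolding independent_iff using finite_incident finite_subset by blast

lemma maximal_extension:
  assumes "independent_set L I"
  obtains J where "maximal_independent_set L J" "I \<subseteq> J"
proof -
  let ?P = "\<lambda>J. independent_set L J \<and> I \<subseteq> J"
  have "\<forall>J. ?P J \<longrightarrow> card J < Suc D"
    unfolding degree_def less_Suc_eq_le independent_iff using card_mono[OF finite_incident] by simp
  then obtain J where J: "?P J" and max: "\<And>K. ?P K \<Longrightarrow> card K \<le> card J"
    using ex_has_greatest_nat[of ?P I card "Suc D"] assms by blast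
  have "K = J" if "independent_set L K" "J \<subseteq> K" for K
  proof (rule card_seteq[symmetric])
    show "finite K" using that independent_finite by blast
    show "card K \<le> card J" using max[of K] that J by blast
  qed (rule that)
  then have "maximal_independent_set L J" using J by (auto simp: maximal_independent_set_def)
  then show ?thesis using that J by blast
qed

text \<open>The absorbing set of the pair has independent \<open>\<sigma> X\<close> containing both
  \<open>I\<close> and \<open>J\<close>; maximality of \<open>I\<close> makes it equal to
  \<open>I\<close>.\<close>

lemma independent_subset_maximal:
  assumes I: "maximal_independent_set L I" and J: "independent_set L J"
    and ef: "e \<in> I \<inter> J" "f \<in> I \<inter> J" "e \<noteq> f"
  shows "J \<subseteq> I"
proof -
  have II: "independent_set L I" using I by (simp add: maximal_independent_set_def)
  have "independent_set L {e, f}" by (rule independent_subset[OF II]) (use ef in auto)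
  then obtain X where X: "dangerous X"
    "\<And>I. independent_set L I \<Longrightarrow> e \<in> I \<Longrightarrow> f \<in> I \<Longrightarrow> I \<subseteq> \<sigma> X"
    using independent_pair_absorbed ef(3) by metis
  have "I \<subseteq> \<sigma> X" "J \<subseteq> \<sigma> X" using X(2) II J ef by auto
  moreover have "\<sigma> X = I"
    using I independent_edges_into[OF X(1)] \<open>I \<subseteq> \<sigma> X\<close> by (auto simp: maximal_independent_set_def)
  ultimately show ?thesis by simp
qed

lemma maximal_sharing_two:
  assumes "maximal_independent_set L I" "maximal_independent_set L J"
    and "e \<in> I \<inter> J" "f \<in> I \<inter> J" "e \<noteq> f"
  shows "I = J"
proof -
  have "J \<subseteq> I" using independent_subset_maximal[of I J e f] assms by (simp add: maximal_independent_set_def)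
  moreover have "I \<subseteq> J"
    using independent_subset_maximal[of J I e f] assms by (simp add: maximal_independent_set_def)
  ultimately show ?thesis by simp
qed

lemma card_maximal_Int_le_1:
  assumes "maximal_independent_set L I" "maximal_independent_set L J" "I \<noteq> J"
  shows "card (I \<inter> J) \<le> 1"
proof (rule ccontr)
  assume "\<not> card (I \<inter> J) \<le> 1"
  then have "\<exists>e\<in>I \<inter> J. \<exists>f\<in>I \<inter> J. e \<noteq> f"
    by (metis One_nat_def card.infinite card_le_Suc0_iff_eq zero_le)
  then show False using maximal_sharing_two assms by blast
qed

lemma maximal_is_edges_into:
  assumes I: "maximal_independent_set L I" and ef: "e \<in> I" "f \<in> I" "e \<noteq> f"
  obtains X where "dangerous X" "I = \<sigma> X"
proof -
  have II: "independent_set L I" using I by (simp add: maximal_independent_set_def)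
  have "independent_set L {e, f}" by (rule independent_subset[OF II]) (use ef in auto)
  then obtain X where X: "dangerous X"
    "\<And>I. independent_set L I \<Longrightarrow> e \<in> I \<Longrightarrow> f \<in> I \<Longrightarrow> I \<subseteq> \<sigma> X"
    using independent_pair_absorbed ef(3) by metis
  have "I = \<sigma> X"
    using I independent_edges_into[OF X(1)] X(2)[OF II ef(1,2)] by (auto simp: maximal_independent_set_def)
  then show ?thesis using that X(1) by blast
qed

text \<open>A common edge and an edge private to each set provide the two elements needed to
  represent both. The private edges also show that neither dangerous set contains the other.\<close>

lemma intersecting_maximal:
  assumes I: "maximal_independent_set L I" and J: "maximal_independent_set L J"
    and IJ: "I \<noteq> J" "I \<inter> J \<noteq> {}"
  obtains X Y where "dangerous X" "dangerous Y" "I = \<sigma> X" "J = \<sigma> Y" "X - Y \<noteq> {}" "Y - X \<noteq> {}"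
proof -
  obtain z where z: "z \<in> I" "z \<in> J" using IJ by auto
  have "\<not> I \<subseteq> J" "\<not> J \<subseteq> I" using I J IJ by (auto simp: maximal_independent_set_def)
  then obtain a b where ab: "a \<in> I" "a \<notin> J" "b \<in> J" "b \<notin> I" by auto
  obtain X where X: "dangerous X" "I = \<sigma> X"
    using maximal_is_edges_into[OF I z(1) ab(1)] z ab by metis
  obtain Y where Y: "dangerous Y" "J = \<sigma> Y"
    using maximal_is_edges_into[OF J z(2) ab(3)] z ab by metis
  have "X - Y \<noteq> {}" "Y - X \<noteq> {}"
    using edges_into_mono[of X Y] edges_into_mono[of Y X] ab X Y by blast+
  then show ?thesis using that X Y by blast
qed

text \<open>The common source of claims (2) to (4). The alternatives correspond to
  \<open>X \<union> Y = U\<close> and its failure. In the second, a dangerous union would make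
  \<open>I \<union> J\<close> independent, so \<open>k\<close> must be odd, and a cut of at most
  \<open>k + 2\<close> bounds the edges into the union.\<close>

lemma intersecting_maximal_card:
  assumes I: "maximal_independent_set L I" and J: "maximal_independent_set L J"
    and IJ: "I \<noteq> J" "I \<inter> J \<noteq> {}"
  shows "odd D \<and> 2 * card I = D + 1 \<and> 2 * card J = D + 1 \<or>
    2 * card (I \<union> J) \<le> D + 2 \<and> odd k"
proof -
  obtain X Y where XY: "dangerous X" "dangerous Y" "I = \<sigma> X" "J = \<sigma> Y" "X - Y \<noteq> {}" "Y - X \<noteq> {}"
    using intersecting_maximal[OF assms] .
  have i: "\<sigma> X \<inter> \<sigma> Y \<noteq> {}" using XY IJ by simp
  show ?thesis
  proof (cases "X \<union> Y = U")
    case True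
    then show ?thesis using crossing_cover[OF XY(1,2) i XY(5,6)] XY by simp
  next
    case False
    note u = crossing_union[OF XY(1,2) i XY(5,6) False]
    have "\<not> dangerous (X \<union> Y)"
    proof
      assume "dangerous (X \<union> Y)"
      then have "independent_set L (I \<union> J)" using independent_edges_into XY edges_into_Un by metis
      then have "I \<union> J = I" "I \<union> J = J" using I J by (auto simp: maximal_independent_set_def)
      then show False using IJ by auto
    qed
    moreover have "2 * card (\<sigma> (X \<union> Y)) + k \<le> d (X \<union> Y) + D"
      using u(1) XY by (intro edges_into_bound) auto
    ultimately show ?thesis using u XY edges_into_Un[of X Y] by auto
  qed
qed

lemma maximal_singleton_intersection:
  assumes "maximal_independent_set L I" "maximal_independent_set L J" "I \<noteq> J" "I \<inter> J \<noteq> {}"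
  obtains z where "I \<inter> J = {z}"
proof -
  obtain z where "z \<in> I \<inter> J" using assms by auto
  then have "I \<inter> J = {z}" using maximal_sharing_two[OF assms(1,2)] assms(3) by blast
  then show ?thesis using that by blast
qed

section \<open>The shape of the lifting graph\<close>

lemma card_incident: "card (fst L) = D"
  by (simp add: fst_L degree_def)

lemma maximal_subset: "maximal_independent_set L I \<Longrightarrow> I \<subseteq> fst L"
  by (simp add: maximal_independent_set_def independent_set_def)

lemma finite_maximal: "maximal_independent_set L I \<Longrightarrow> finite I"
  using independent_finite by (simp add: maximal_independent_set_def)

text \<open>The second alternative would say \<open>2 * D \<le> D + 2\<close>, against
  \<open>D\<close> at least 4.\<close>

lemma spanning_pair:
  assumes I: "maximal_independent_set L I" and J: "maximal_independent_set L J"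
    and IJ: "I \<noteq> J" "I \<inter> J \<noteq> {}" "I \<union> J = fst L"
  shows "odd D \<and> 2 * card I = D + 1 \<and> 2 * card J = D + 1"
  using intersecting_maximal_card[OF I J IJ(1,2)] IJ(3) card_incident deg4 by auto

lemma not_adjacent_iff:
  assumes "e \<in> fst L" "f \<in> fst L"
  shows "{e, f} \<notin> snd L \<longleftrightarrow> independent_set L {e, f}"
  using adjacent_iff[of e f] assms unfolding fst_L independent_iff by blast

lemma not_adjacent_iff_maximal:
  assumes "e \<in> fst L" "f \<in> fst L"
  shows "{e, f} \<notin> snd L \<longleftrightarrow> (\<exists>I. maximal_independent_set L I \<and> e \<in> I \<and> f \<in> I)"
proof
  assume "{e, f} \<notin> snd L"
  then have "independent_set L {e, f}" using not_adjacent_iff assms by blast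
  then obtain I where "maximal_independent_set L I" "{e, f} \<subseteq> I" by (rule maximal_extension)
  then show "\<exists>I. maximal_independent_set L I \<and> e \<in> I \<and> f \<in> I" by blast
qed (auto simp: maximal_independent_set_def independent_set_def)

text \<open>Sharing one vertex, \<open>I\<close> and \<open>J\<close> together have \<open>D\<close>
  elements and so cover all vertices. Then \<open>z\<close> has no neighbour and belongs to every
  maximal independent set, and any further element of such a set identifies it with \<open>I\<close>
  or \<open>J\<close>.\<close>

lemma balanced_pair:
  assumes I: "maximal_independent_set L I" and J: "maximal_independent_set L J"
    and IJ: "I \<noteq> J" "I \<inter> J \<noteq> {}" and cI: "2 * card I = D + 1" "2 * card J = D + 1"
  shows "\<exists>z H. isolated_vertex_plus L z H \<and> balanced_complete_bipartite H \<and>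
    {K. maximal_independent_set L K} = {I, J} \<and> I \<inter> J = {z}"
proof -
  obtain z where z: "I \<inter> J = {z}" using maximal_singleton_intersection[OF I J IJ] .
  note fin = finite_maximal[OF I] finite_maximal[OF J]
  have "card I + card J = card (I \<union> J) + card (I \<inter> J)" by (rule card_Un_Int[OF fin])
  then have cardUn: "card (I \<union> J) = D" using z cI by simp
  have span: "I \<union> J = fst L"
  proof (rule card_seteq)
    show "finite (fst L)" using finite_incident fst_L by simp
    show "I \<union> J \<subseteq> fst L" using maximal_subset I J by blast
    show "card (fst L) \<le> card (I \<union> J)" using cardUn card_incident by simp
  qed
  have only: "K = I \<or> K = J" if K: "maximal_independent_set L K" for K
  proof -
    have KI: "independent_set L K" using K by (simp add: maximal_independent_set_def)
    have "independent_set L (insert z K)"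
    proof -
      have "{z, x} \<notin> snd L" if "x \<in> fst L" for x
        using that span z I J not_adjacent_iff_maximal[of z x] by blast
      moreover have "{x, z} \<notin> snd L" if "x \<in> fst L" for x
        using calculation[OF that] by (simp add: insert_commute)
      moreover have "z \<in> fst L" using z span by blast
      moreover have "{z} \<notin> snd L" using calculation(1)[OF calculation(3)] by simp
      ultimately show ?thesis using KI by (auto simp: independent_set_def)
    qed
    then have zK: "z \<in> K" using K by (auto simp: maximal_independent_set_def)
    have "\<not> K \<subseteq> {z}"
    proof
      assume "K \<subseteq> {z}"
      then have "K \<subseteq> I" "K \<subseteq> J" using z by auto
      then have "I = K" "J = K" using K I J unfolding maximal_independent_set_def by blast+
      then show False using IJ by simp
    qed
    then obtain a where a: "a \<in> K" "a \<noteq> z" by auto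
    have "a \<in> I \<or> a \<in> J" using a(1) span maximal_subset[OF K] by blast
    then show ?thesis using maximal_sharing_two[OF K I, of a z] maximal_sharing_two[OF K J, of a z] zK a z
      by blast
  qed
  define A where "A = I - {z}"
  define B where "B = J - {z}"
  have AB: "A \<inter> B = {}" "card A = card B" "finite A" "finite B"
    using z cI fin by (auto simp: A_def B_def card_Diff_singleton_if)
  have fstL: "fst L = insert z (A \<union> B)" using span z by (auto simp: A_def B_def)
  have adj: "{x, y} \<in> snd L \<longleftrightarrow> x \<in> A \<and> y \<in> B \<or> x \<in> B \<and> y \<in> A" if "x \<in> fst L" "y \<in> fst L" for x y
  proof -
    have "{x, y} \<notin> snd L \<longleftrightarrow> x \<in> I \<and> y \<in> I \<or> x \<in> J \<and> y \<in> J"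
      using not_adjacent_iff_maximal[OF that] only I J by blast
    then show ?thesis using that span z unfolding A_def B_def by blast
  qed
  have sndL: "snd L = {{a, b} | a b. a \<in> A \<and> b \<in> B}"
  proof (intro equalityI subsetI)
    fix p assume p: "p \<in> snd L"
    then obtain x y where xy: "p = {x, y}" "x \<in> fst L" "y \<in> fst L" using snd_L_subset by blast
    then show "p \<in> {{a, b} | a b. a \<in> A \<and> b \<in> B}" using adj[OF xy(2,3)] p by blast
  next
    fix p assume "p \<in> {{a, b} | a b. a \<in> A \<and> b \<in> B}"
    then obtain a b where "p = {a, b}" "a \<in> A" "b \<in> B" by blast
    then show "p \<in> snd L" using adj[of a b] fstL by blast
  qed
  have "isolated_vertex_plus L z (A \<union> B, snd L)"
    using fstL by (simp add: isolated_vertex_plus_def A_def B_def prod_eq_iff)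
  moreover have "balanced_complete_bipartite (A \<union> B, snd L)"
    using AB sndL by (auto simp: balanced_complete_bipartite_def)
  moreover have "{K. maximal_independent_set L K} = {I, J}" using only I J by blast
  ultimately show ?thesis using z by blast
qed

text \<open>The parts are the maximal independent sets, and non-adjacency means lying in a common
  one.\<close>

lemma disjoint_imp_complete_multipartite:
  assumes disj: "\<And>I J. maximal_independent_set L I \<Longrightarrow> maximal_independent_set L J \<Longrightarrow> I \<noteq> J \<Longrightarrow> I \<inter> J = {}"
  shows "complete_multipartite L"
proof -
  define P where "P = {I. maximal_independent_set L I}"
  have vertex: "\<exists>I\<in>P. x \<in> I" if "x \<in> fst L" for x
    using not_adjacent_iff_maximal[OF that that] not_adjacent_iff[OF that that] that
    unfolding P_def fst_L independent_iff by auto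
  have ne: "{} \<notin> P"
  proof
    assume "{} \<in> P"
    moreover have "fst L \<noteq> {}" using card_incident deg4 by auto
    then obtain I where "I \<in> P" "I \<noteq> {}" using vertex by blast
    ultimately show False by (auto simp: P_def maximal_independent_set_def)
  qed
  have part: "partition_on (fst L) P"
  proof (rule partition_onI)
    show "\<Union> P = fst L" using vertex maximal_subset by (auto simp: P_def)
    show "disjnt p q" if "p \<in> P" "q \<in> P" "p \<noteq> q" for p q
      using disj that by (auto simp: P_def disjnt_def)
    show "{} \<notin> P" by (rule ne)
  qed
  have adj: "{x, y} \<in> snd L \<longleftrightarrow> (\<exists>p\<in>P. \<exists>q\<in>P. p \<noteq> q \<and> x \<in> p \<and> y \<in> q)"
    if xy: "x \<in> fst L" "y \<in> fst L" for x y
  proof -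
    obtain p q where pq: "p \<in> P" "q \<in> P" "x \<in> p" "y \<in> q" using vertex[OF xy(1)] vertex[OF xy(2)] by blast
    have uniq: "p' = q'" if "p' \<in> P" "q' \<in> P" "w \<in> p'" "w \<in> q'" for p' q' w
      using that disj by (auto simp: P_def)
    have "{x, y} \<notin> snd L \<longleftrightarrow> (\<exists>r\<in>P. x \<in> r \<and> y \<in> r)"
      using not_adjacent_iff_maximal[OF xy] by (auto simp: P_def)
    then show ?thesis using pq uniq by blast
  qed
  have "snd L = {{x, y} | x y. \<exists>p \<in> P. \<exists>q \<in> P. p \<noteq> q \<and> x \<in> p \<and> y \<in> q}" (is "_ = ?R")
  proof (intro equalityI subsetI)
    fix e assume e: "e \<in> snd L"
    then obtain x y where xy: "e = {x, y}" "x \<in> fst L" "y \<in> fst L" using snd_L_subset by blast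
    then show "e \<in> ?R" using adj[OF xy(2,3)] e by blast
  next
    fix e assume "e \<in> ?R"
    then obtain x y where xy: "e = {x, y}" and pq: "\<exists>p \<in> P. \<exists>q \<in> P. p \<noteq> q \<and> x \<in> p \<and> y \<in> q" by blast
    then have "x \<in> fst L" "y \<in> fst L" using maximal_subset by (auto simp: P_def)
    then show "e \<in> snd L" using adj xy pq by blast
  qed
  with part show ?thesis unfolding complete_multipartite_def by blast
qed

text \<open>The \<open>D - 1\<close> leaves of a star would lie in one maximal independent set,
  hence in some \<open>\<sigma> X\<close> of size at most \<open>(D + 1) / 2\<close>, forcing
  \<open>D\<close> to be at most 3.\<close>

lemma not_star: "\<not> star L"
proof
  assume "star L"
  then obtain c where c: "c \<in> fst L" "snd L = {{c, x} | x. x \<in> fst L - {c}}" unfolding star_def by blast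
  have ind: "independent_set L (fst L - {c})"
    unfolding independent_set_def c(2) by (auto simp: doubleton_eq_iff)
  then obtain I where I: "maximal_independent_set L I" "fst L - {c} \<subseteq> I" by (rule maximal_extension)
  have card: "card (fst L - {c}) = D - 1" using c(1) card_incident by simp
  then have "\<not> card (fst L - {c}) \<le> Suc 0" using deg4 by simp
  then obtain a b where "a \<in> fst L - {c}" "b \<in> fst L - {c}" "a \<noteq> b"
    by (metis card.infinite card_le_Suc0_iff_eq zero_le)
  then obtain X where X: "dangerous X" "I = \<sigma> X" using maximal_is_edges_into[OF I(1), of a b] I(2) by blast
  have "D - 1 \<le> card (\<sigma> X)" using card_mono[OF finite_maximal[OF I(1)] I(2)] card X by simp
  then show False using dangerous_edges_bound[OF X(1)] deg4 by linarith
qed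

end

section \<open>Assembly of the claims\<close>

theorem theorem3p5:
  fixes G :: "('v, 'e) multigraph" and s :: 'v and k :: nat
    and d :: nat and L :: "'e sgraph"
  defines "d \<equiv> degree G s" and "L \<equiv> lifting_graph G s k"
  assumes "sk_edge_connected G s k" and "k \<ge> 2" and "d \<ge> 4"
  shows
    "(\<forall>I J. maximal_independent_set L I \<and> maximal_independent_set L J \<and> I \<noteq> J
        \<longrightarrow> card (I \<inter> J) \<le> 1) \<and>
     (\<forall>I J. maximal_independent_set L I \<and> maximal_independent_set L J \<and> I \<noteq> J \<and>
        I \<inter> J \<noteq> {} \<and> I \<union> J = fst L
        \<longrightarrow> odd d \<and> card I = (d + 1) div 2 \<and> card J = (d + 1) div 2) \<and>
     (d > 4 \<longrightarrow>
       (\<forall>I J. maximal_independent_set L I \<and> maximal_independent_set L J \<and> I \<noteq> J \<and>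
          I \<inter> J \<noteq> {} \<and> int (card I) = \<lceil>real d / 2\<rceil> \<and> int (card J) = \<lceil>real d / 2\<rceil>
          \<longrightarrow> (\<exists>z H. isolated_vertex_plus L z H \<and> balanced_complete_bipartite H \<and>
                 {K. maximal_independent_set L K} = {I, J} \<and> I \<inter> J = {z}))) \<and>
     (even k \<and>
      (even d \<or>
       (\<forall>I J. independent_set L I \<and> int (card I) = \<lceil>real d / 2\<rceil> \<and>
              independent_set L J \<and> int (card J) = \<lceil>real d / 2\<rceil> \<longrightarrow> I = J))
      \<longrightarrow> (\<forall>I J. maximal_independent_set L I \<and> maximal_independent_set L J \<and> I \<noteq> J
              \<longrightarrow> I \<inter> J = {}) \<and>
          complete_multipartite L) \<and>
     (complete_multipartite L \<longrightarrow> \<not> star L)"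
proof -
  interpret sk_connected_graph G s k
    using assms by unfold_locales (simp_all add: d_def)
  have ceil: "\<lceil>real d / 2\<rceil> = int ((d + 1) div 2)"
  proof (cases "even d")
    case True
    then obtain m where "d = 2 * m" by (rule evenE)
    then show ?thesis by simp
  next
    case False
    then obtain m where "d = 2 * m + 1" by (rule oddE)
    then show ?thesis by (simp add: ceiling_eq_iff)
  qed
  note defs = d_def L_def
  have p1: "card (I \<inter> J) \<le> 1"
    if "maximal_independent_set L I" "maximal_independent_set L J" "I \<noteq> J" for I J
    using card_maximal_Int_le_1 that by (simp add: defs)
  have p2: "odd d \<and> card I = (d + 1) div 2 \<and> card J = (d + 1) div 2"
    if "maximal_independent_set L I" "maximal_independent_set L J" "I \<noteq> J" "I \<inter> J \<noteq> {}"
      "I \<union> J = fst L" for I J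
  proof -
    have "odd d \<and> 2 * card I = d + 1 \<and> 2 * card J = d + 1"
      using spanning_pair that by (simp add: defs)
    then show ?thesis by auto
  qed
  have p3: "\<exists>z H. isolated_vertex_plus L z H \<and> balanced_complete_bipartite H \<and>
      {K. maximal_independent_set L K} = {I, J} \<and> I \<inter> J = {z}"
    if d: "d > 4" and I: "maximal_independent_set L I" "maximal_independent_set L J"
      and IJ: "I \<noteq> J" "I \<inter> J \<noteq> {}"
      and c: "int (card I) = \<lceil>real d / 2\<rceil>" "int (card J) = \<lceil>real d / 2\<rceil>" for I J
  proof -
    note I' = I[unfolded L_def]
    have cI: "card I = (d + 1) div 2" "card J = (d + 1) div 2" using c ceil by simp_all
    obtain z where "I \<inter> J = {z}" using maximal_singleton_intersection[OF I' IJ] .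
    then have un: "card I + card J = card (I \<union> J) + 1"
      using card_Un_Int[OF finite_maximal[OF I'(1)] finite_maximal[OF I'(2)]] by simp
    have "d \<le> 2 * card I" "d \<le> 2 * card J" using cI by linarith+
    \<comment> \<open>The union has at least \<open>d - 1\<close> elements, and
      \<open>2 * d - 2\<close> exceeds \<open>d + 2\<close> exactly when
      \<open>d > 4\<close>.\<close>
    then have "\<not> 2 * card (I \<union> J) \<le> d + 2" using un d by linarith
    then have "odd d \<and> 2 * card I = d + 1 \<and> 2 * card J = d + 1"
      using intersecting_maximal_card[OF I' IJ] unfolding d_def by blast
    then show ?thesis using balanced_pair[OF I' IJ] by (simp add: defs)
  qed
  have p4: "I \<inter> J = {}"
    if k: "even k" and or: "even d \<or> (\<forall>I J. independent_set L I \<and> int (card I) = \<lceil>real d / 2\<rceil> \<and>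
              independent_set L J \<and> int (card J) = \<lceil>real d / 2\<rceil> \<longrightarrow> I = J)"
      and I: "maximal_independent_set L I" "maximal_independent_set L J" and IJ: "I \<noteq> J" for I J
  proof (rule ccontr)
    assume "I \<inter> J \<noteq> {}"
    \<comment> \<open>Even \<open>k\<close> leaves only the first alternative. It makes
      \<open>d\<close> odd and gives two different independent sets of the size that the hypothesis
      allows at most once.\<close>
    from intersecting_maximal_card[OF I[unfolded L_def] IJ this] k
    have c: "odd d" "2 * card I = d + 1" "2 * card J = d + 1" by (simp_all add: d_def)
    then have "card I = (d + 1) div 2" "card J = (d + 1) div 2" by auto
    then have "int (card I) = \<lceil>real d / 2\<rceil>" "int (card J) = \<lceil>real d / 2\<rceil>" using ceil by simp_all
    then have "I = J" using or c(1) I by (auto simp: maximal_independent_set_def)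
    with IJ show False by simp
  qed
  have p5: "complete_multipartite L"
    if "\<And>I J. maximal_independent_set L I \<Longrightarrow> maximal_independent_set L J \<Longrightarrow> I \<noteq> J \<Longrightarrow> I \<inter> J = {}"
    using disjoint_imp_complete_multipartite that unfolding L_def by blast
  have p6: "\<not> star L" using not_star by (simp add: L_def)
  show ?thesis
    by (intro conjI allI impI) (use p1 p2 p3 p4 p5 p6 in blast)+
qed

end
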